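(* Let $\alpha\in\mathbb{R}$ be given with a rational approximation $\alpha=\frac aq+\beta$, where $a\in\mathbb{Z}$, $q\ge1$, $(a,q)=1$ and $q^2|\beta|\le1$. For $N\ge2$, $R\ge1$ and any $\varepsilon>0$, we have $$\sum_{r\le R}|S(r\alpha;N)|\ll_\varepsilon\frac{RN}{\sqrt{\log N}}\left(\frac{1}{\sqrt q}+\frac{\sqrt q}{\sqrt{RN}}+\frac{1}{R^{1/3}N^{1/6}}+\frac{R^{1/3}}{N^{1/3}}\right)N^\varepsilon.$$
   Context: $\mathfrak{B}$ is the set of odd positive integers that are sums of two coprime squares (equivalently, odd positive integers with no prime factor $\equiv3\pmod4$), $b$ its characteristic function, $e(x)=e^{2\pi ix}$ and $S(\alpha;N)=\sum_{n\le N}b(n)e(n\alpha)$. The sum over $r$ is over positive integers. *)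

theory Defs
  imports Complex_Main
begin

definition BB :: "nat set" where
  "BB = {n. n > 0 \<and> odd n \<and> (\<exists>x y :: int. coprime x y \<and> int n = x\<^sup>2 + y\<^sup>2)}"

definition b_char :: "nat \<Rightarrow> complex" where
  "b_char n = of_bool (n \<in> BB)"

definition e_char :: "real \<Rightarrow> complex" where
  "e_char x = exp (2 * of_real pi * \<i> * of_real x)"

definition S_sum :: "real \<Rightarrow> real \<Rightarrow> complex" where
  "S_sum \<alpha> N = (\<Sum>n | 0 < n \<and> real n \<le> N. b_char n * e_char (real n * \<alpha>))"

end

theory Submission
  imports Defs "HOL-Analysis.Harmonic_Numbers" "HOL-Analysis.Convex"
    "HOL-Number_Theory.Euler_Criterion" "HOL-Computational_Algebra.Squarefree"
begin

text \<open>
  Every \<open>n \<equiv> 1\<close> modulo 4 has an even number of prime factors congruent to 3 modulo 4, so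
  for \<open>n \<le> N\<close> membership in \<open>BB\<close> is detected by sieving with the primes
  \<open>p \<equiv> 3\<close> modulo 4 with \<open>p\<^sup>2 \<le> N\<close>. Pairing \<open>d\<close> with \<open>s d\<close>, where \<open>s\<close> is
  the least sieving prime of \<open>n\<close>, writes the indicator as a divisor sum over \<open>d \<le> X\<close> plus
  a sum over factorisations \<open>n = u w\<close> with \<open>X < u \<le> X\<^sup>2\<close>, subject to the condition that the
  least prime of \<open>u\<close> does not exceed the least sieving prime of \<open>w\<close>; here \<open>N \<le> X\<^sup>4\<close> makes
  \<open>u\<close> stay below \<open>X\<^sup>2\<close>. The first part is a sum of geometric series. In the second part
  that condition and \<open>u w \<le> N\<close> are separated by finite Fourier analysis at a logarithmic cost,
  and \<open>r u = l\<close> is treated as one variable in Cauchy's inequality, the multiplicities being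
  controlled by the mean square of the divisor function. Both parts reduce to Vinogradov's bound
  for the sum over \<open>l \<le> L\<close> of the minimum of \<open>Z / l\<close> and the reciprocal distance of
  \<open>l \<alpha>\<close> to the nearest integer. The choice
  \<open>X = max ((N / R) powr (1/3)) (N powr (1/4))\<close> balances the terms, and the logarithms are
  absorbed into \<open>N powr \<epsilon>\<close>.
\<close>

section \<open>Geometric sums and rational approximation\<close>

text \<open>Merging \<open>r * u\<close> into one variable brings in the divisor function. No
  pointwise bound for it is used: Cauchy's inequality asks only for the sum of its square over
  \<open>l\<close>, weighted by \<open>1 / l\<close>, and that is a power of a logarithm. Under the
  square root the cutoff enters through \<open>R * X\<^sup>2\<close> and \<open>N / X\<close>, which
  balance at \<open>X ^ 3 = N / R\<close> and give the third term of the theorem. The constraint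
  \<open>N \<le> X ^ 4\<close> forces \<open>X\<close> up to \<open>N powr (1/4)\<close>; where that
  value dominates, \<open>R\<close> is at least \<open>N powr (1/4)\<close>, and the fourth term
  absorbs the loss. The first two terms come from Vinogradov's bound. The factor
  \<open>1 / sqrt (ln N)\<close> is not extracted from the density of \<open>BB\<close>: it is paid
  for by \<open>N powr \<epsilon>\<close>, as the logarithms are.\<close>

lemma e_char_eq_cis: "e_char x = cis (2 * pi * x)"
  by (simp add: e_char_def cis_conv_exp mult_ac)

lemma norm_e_char [simp]: "cmod (e_char x) = 1"
  by (simp add: e_char_eq_cis)

lemma e_char_add: "e_char (x + y) = e_char x * e_char y"
  by (simp add: e_char_eq_cis cis_mult distrib_left)

lemma e_char_uminus: "e_char (- x) = cnj (e_char x)"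
  by (simp add: e_char_eq_cis cis_cnj)

lemma e_char_of_nat_mult: "e_char (real k * x) = e_char x ^ k"
  by (simp add: e_char_eq_cis Complex.DeMoivre mult.left_commute)

lemma e_char_of_int [simp]: "e_char (of_int k) = 1"
  by (simp add: e_char_eq_cis)

lemma e_char_0 [simp]: "e_char 0 = 1"
  using e_char_of_int[of 0] by simp

lemma e_char_frac: "e_char (frac x) = e_char x"
proof -
  have "e_char x = e_char (of_int \<lfloor>x\<rfloor> + frac x)"
    by (simp add: frac_def)
  thus ?thesis
    by (simp only: e_char_add e_char_of_int mult_1)
qed

lemma norm_e_char_diff_1: "cmod (e_char x - 1) = 2 * \<bar>sin (pi * x)\<bar>"
proof -
  have "e_char x - 1 = 2 * \<i> * of_real (sin (pi * x)) * cis (pi * x)"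
    using sin_double[of "pi * x"] cos_double_sin[of "pi * x"]
    by (simp add: e_char_eq_cis complex_eq_iff power2_eq_square mult_ac)
  thus ?thesis
    by (simp add: norm_mult)
qed

text \<open>Jordan's inequality: by concavity, sine lies above its chord from 0 to
  \<open>pi / 2\<close>.\<close>

lemma jordan_sin_pi_le:
  assumes "0 \<le> x" "x \<le> 1/2"
  shows "2 * x \<le> sin (pi * x)"
proof -
  have "convex_on {0..pi} (\<lambda>x::real. - sin x)"
  proof (rule f''_ge0_imp_convex)
    show "((\<lambda>x. - sin x) has_real_derivative - cos x) (at x)" for x
      by (auto intro!: derivative_eq_intros)
    show "((\<lambda>x. - cos x) has_real_derivative sin x) (at x)" for x
      by (auto intro!: derivative_eq_intros)
  qed (auto intro: sin_ge_zero)
  from convex_onD[OF this, of "2 * x" 0 "pi / 2"] assms show ?thesis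
    by (simp add: mult_ac)
qed

text \<open>Only the smaller of \<open>x\<close> and \<open>1 - x\<close> matters; adding both
  reciprocals keeps the bound free of cases when it is summed later.\<close>

lemma inverse_sin_pi_le:
  assumes "0 < x" "x < 1"
  shows "1 / sin (pi * x) \<le> 1 / (2 * x) + 1 / (2 * (1 - x))"
proof (cases "x \<le> 1/2")
  case True
  have "1 / sin (pi * x) \<le> 1 / (2 * x)"
    using jordan_sin_pi_le[of x] True assms by (intro divide_left_mono mult_pos_pos) auto
  thus ?thesis using assms by (simp add: add_increasing2)
next
  case False
  have "sin (pi * x) = sin (pi * (1 - x))"
    by (simp add: algebra_simps)
  also have "1 / \<dots> \<le> 1 / (2 * (1 - x))"
    using jordan_sin_pi_le[of "1 - x"] False assms by (intro divide_left_mono mult_pos_pos) auto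
  finally show ?thesis using assms by (simp add: add_increasing)
qed

text \<open>Stands for the minimum of \<open>Z\<close> and the reciprocal distance of
  \<open>x\<close> to the nearest integer, since \<open>cmod (e_char x - 1)\<close> is comparable to
  that distance. Integers \<open>x\<close> are split off because division by zero would turn the
  minimum into 0 for nonnegative \<open>Z\<close>.\<close>

definition geom_bound :: "real \<Rightarrow> real \<Rightarrow> real" where
  "geom_bound Z x = (if e_char x = 1 then Z else min Z (2 / cmod (e_char x - 1)))"

lemma geom_bound_le: "geom_bound Z x \<le> Z"
  by (simp add: geom_bound_def)

lemma geom_bound_nonneg: "0 \<le> Z \<Longrightarrow> 0 \<le> geom_bound Z x"
  by (simp add: geom_bound_def)

lemma geom_bound_mono: "Z \<le> Z' \<Longrightarrow> geom_bound Z x \<le> geom_bound Z' x"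
  by (auto simp: geom_bound_def)

lemma geom_bound_uminus: "geom_bound Z (- x) = geom_bound Z x"
proof -
  have "cmod (cnj (e_char x) - 1) = cmod (e_char x - 1)"
    by (metis complex_cnj_diff complex_cnj_one complex_mod_cnj)
  moreover have "cnj (e_char x) = 1 \<longleftrightarrow> e_char x = 1"
    by (metis complex_cnj_cnj complex_cnj_one)
  ultimately show ?thesis
    by (simp add: geom_bound_def e_char_uminus)
qed

lemma norm_geom_sum_le: "cmod (\<Sum>k<n. e_char (real k * x)) \<le> geom_bound (real n) x"
proof -
  have "cmod (\<Sum>k<n. e_char (real k * x)) \<le> (\<Sum>k<n. 1)"
    by (rule sum_norm_le) simp
  hence triv: "cmod (\<Sum>k<n. e_char (real k * x)) \<le> real n"
    by simp
  show ?thesis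
  proof (cases "e_char x = 1")
    case False
    have "(\<Sum>k<n. e_char (real k * x)) = (e_char x ^ n - 1) / (e_char x - 1)"
      using geometric_sum[OF False] by (simp add: e_char_of_nat_mult)
    also have "cmod \<dots> \<le> 2 / cmod (e_char x - 1)"
    proof -
      have "cmod (e_char x ^ n - 1) \<le> cmod (e_char x ^ n) + cmod 1"
        by (rule norm_triangle_ineq4)
      thus ?thesis
        by (simp add: norm_divide norm_power divide_right_mono)
    qed
    finally show ?thesis using triv False by (simp add: geom_bound_def)
  qed (use triv in \<open>simp add: geom_bound_def\<close>)
qed

text \<open>The circle is cut into \<open>2 * q\<close> arcs of length \<open>1 / (2 * q)\<close>,
  the spacing established in \<open>separation\<close>. The arcs with index 0 and
  \<open>2 * q - 1\<close> are those adjacent to an integer.\<close>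

definition bin_index :: "nat \<Rightarrow> real \<Rightarrow> nat" where
  "bin_index q x = nat \<lfloor>2 * real q * frac x\<rfloor>"

lemma bin_bounds:
  assumes "q \<ge> 1"
  shows "real (bin_index q x) \<le> 2 * real q * frac x" "2 * real q * frac x < real (bin_index q x) + 1"
    "bin_index q x < 2 * q"
proof -
  have nn: "0 \<le> 2 * real q * frac x"
    by (simp add: frac_ge_0)
  show "real (bin_index q x) \<le> 2 * real q * frac x" "2 * real q * frac x < real (bin_index q x) + 1"
    using nn unfolding bin_index_def by linarith+
  have "2 * real q * frac x < 2 * real q"
    using assms frac_lt_1[of x] by simp
  thus "bin_index q x < 2 * q"
    using nn unfolding bin_index_def by linarith
qed

lemma geom_bound_le_bin:
  assumes "q \<ge> 1" "bin_index q x \<noteq> 0" "bin_index q x \<noteq> 2 * q - 1"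
  shows "geom_bound Z x \<le> q / bin_index q x + q / (2 * real q - 1 - bin_index q x)"
proof -
  define k y where "k = bin_index q x" and "y = frac x"
  note b = bin_bounds[OF assms(1), of x, folded k_def y_def]
  have k: "0 < k" "k < 2 * q - 1" using assms b unfolding k_def by auto
  have kr: "real (2 * q - 1 - k) = 2 * real q - 1 - real k" "2 * real q - 1 - real k > 0"
    using k by (auto simp: of_nat_diff)
  have q: "real q > 0" using assms by simp
  have y1: "k / (2 * q) \<le> y" using b q by (simp add: field_simps)
  have y2: "(2 * real q - 1 - real k) / (2 * q) \<le> 1 - y" using b q by (simp add: field_simps)
  have y0: "0 < y" using y1 k q by (intro less_le_trans[OF _ y1] divide_pos_pos) auto
  have y01: "y < 1" by (simp add: y_def frac_lt_1)
  have s: "sin (pi * y) > 0" using y0 y01 by (intro sin_gt_zero) auto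
  have "cmod (e_char x - 1) = 2 * sin (pi * y)"
    using s norm_e_char_diff_1[of y] by (simp add: y_def e_char_frac)
  hence "2 / cmod (e_char x - 1) = 1 / sin (pi * y)" "e_char x \<noteq> 1" using s by auto
  hence "geom_bound Z x \<le> 1 / sin (pi * y)"
    by (simp add: geom_bound_def)
  also have "\<dots> \<le> 1 / (2 * y) + 1 / (2 * (1 - y))"
    using y0 y01 by (rule inverse_sin_pi_le)
  also have "\<dots> \<le> 1 / (k / q) + 1 / ((2 * real q - 1 - real k) / q)"
    using y1 y2 y0 y01 k kr q by (intro add_mono divide_left_mono mult_pos_pos) (auto simp: field_simps)
  finally show ?thesis
    using kr by (simp add: k_def)
qed

section \<open>Spacing of the multiples of \<alpha> and Vinogradov's bound\<close>

locale rational_approx =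
  fixes \<alpha> \<beta> :: real and a :: int and q :: nat
  assumes q_ge_1: "q \<ge> 1" and coprime: "coprime a (int q)"
    and approx: "\<alpha> = of_int a / real q + \<beta>" and beta_le: "(real q)\<^sup>2 * \<bar>\<beta>\<bar> \<le> 1"
begin

text \<open>Since \<open>q\<close> does not divide \<open>d * a\<close>, the fraction
  \<open>d * a / q\<close> is at least \<open>1 / q\<close> away from every integer, and
  \<open>beta_le\<close> keeps the perturbation \<open>d * \<beta>\<close> below
  \<open>1 / (2 * q)\<close>.\<close>

lemma separation:
  fixes d t :: int
  assumes "d \<noteq> 0" "2 * \<bar>d\<bar> < q"
  shows "1 / (2 * real q) < \<bar>of_int d * \<alpha> - of_int t\<bar>"
proof -
  have q: "real q > 0" using q_ge_1 by simp
  have "\<not> int q dvd d"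
    using assms zdvd_imp_le[of "int q" "\<bar>d\<bar>"] by auto
  hence "\<not> int q dvd d * a"
    using coprime by (simp add: coprime_commute coprime_dvd_mult_left_iff)
  hence "d * a - t * int q \<noteq> 0"
    by (metis dvd_triv_right eq_iff_diff_eq_0)
  hence "1 \<le> \<bar>d * a - t * int q\<bar>" by linarith
  hence "1 \<le> \<bar>real_of_int (d * a - t * int q)\<bar>" by linarith
  hence "1 \<le> \<bar>of_int d * of_int a - of_int t * real q\<bar>" by simp
  moreover have "of_int d * of_int a - of_int t * real q = (of_int d * \<alpha> - of_int t - of_int d * \<beta>) * real q"
    using q by (simp add: approx field_simps)
  ultimately have "1 \<le> \<bar>of_int d * \<alpha> - of_int t - of_int d * \<beta>\<bar> * real q"
    using q by (simp add: abs_mult)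
  hence 1: "1 / real q \<le> \<bar>of_int d * \<alpha> - of_int t - of_int d * \<beta>\<bar>"
    using q by (simp add: field_simps)
  have "2 * \<bar>real_of_int d\<bar> < real q" using assms(2) by linarith
  moreover have "\<bar>\<beta>\<bar> \<le> 1 / (real q)\<^sup>2" using beta_le q by (simp add: field_simps)
  ultimately have "2 * \<bar>of_int d\<bar> * \<bar>\<beta>\<bar> \<le> 2 * \<bar>of_int d\<bar> * (1 / (real q)\<^sup>2)"
    "2 * \<bar>of_int d\<bar> * (1 / (real q)\<^sup>2) < real q * (1 / (real q)\<^sup>2)"
    using q by (intro mult_left_mono mult_strict_right_mono; simp)+
  hence "2 * \<bar>of_int d\<bar> * \<bar>\<beta>\<bar> < real q * (1 / (real q)\<^sup>2)"
    by (rule le_less_trans)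
  hence "2 * \<bar>of_int d * \<beta>\<bar> < 1 / real q"
    using q by (simp add: abs_mult power2_eq_square)
  moreover have "1 / (2 * real q) = (1 / real q) / 2" by simp
  ultimately show ?thesis using 1 by linarith
qed

text \<open>\<open>(q + 1) div 2\<close> is the largest block length for which all differences
  satisfy \<open>2 * \<bar>d\<bar> < q\<close>; by \<open>separation\<close> two multiples in one
  block are then more than an arc apart.\<close>

lemma inj_on_bin: "inj_on (\<lambda>l. bin_index q (real l * \<alpha>)) {l0..<l0 + (q + 1) div 2}"
proof (rule inj_onI, rule ccontr)
  fix l l' assume l: "l \<in> {l0..<l0 + (q + 1) div 2}" "l' \<in> {l0..<l0 + (q + 1) div 2}"
    and eq: "bin_index q (real l * \<alpha>) = bin_index q (real l' * \<alpha>)" and ne: "l \<noteq> l'"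
  define t where "t = \<lfloor>real l * \<alpha>\<rfloor> - \<lfloor>real l' * \<alpha>\<rfloor>"
  have "1 / (2 * real q) < \<bar>of_int (int l - int l') * \<alpha> - of_int t\<bar>"
  proof (rule separation)
    define D where "D = (q + 1) div 2"
    have "2 * D \<le> q + 1" "l < l0 + D" "l' < l0 + D" "l0 \<le> l" "l0 \<le> l'"
      using l by (auto simp: D_def)
    thus "2 * \<bar>int l - int l'\<bar> < int q"
      by presburger
  qed (use ne in auto)
  also have "of_int (int l - int l') * \<alpha> - of_int t = frac (real l * \<alpha>) - frac (real l' * \<alpha>)"
    by (simp add: t_def frac_def algebra_simps)
  finally have "2 * real q * (1 / (2 * real q)) < 2 * real q * \<bar>frac (real l * \<alpha>) - frac (real l' * \<alpha>)\<bar>"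
    using q_ge_1 by (intro mult_strict_left_mono) auto
  also have "\<dots> = \<bar>2 * real q * frac (real l * \<alpha>) - 2 * real q * frac (real l' * \<alpha>)\<bar>"
    by (simp add: abs_mult flip: right_diff_distrib)
  finally have "1 < \<bar>2 * real q * frac (real l * \<alpha>) - 2 * real q * frac (real l' * \<alpha>)\<bar>"
    using q_ge_1 by simp
  moreover note bin_bounds[OF q_ge_1, of "real l * \<alpha>"] bin_bounds[OF q_ge_1, of "real l' * \<alpha>"]
  ultimately show False using eq by linarith
qed

text \<open>\<open>separation\<close> with \<open>d = l\<close> keeps the first block out of both
  arcs next to an integer. This rescues the one block in which the cap \<open>Z / l\<close> cannot
  be made small.\<close>

lemma bin_small:
  assumes "0 < l" "l < (q + 1) div 2"
  shows "bin_index q (real l * \<alpha>) \<noteq> 0" "bin_index q (real l * \<alpha>) \<noteq> 2 * q - 1"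
proof -
  have q: "real q > 0" using q_ge_1 by simp
  have s: "1 / (2 * real q) < \<bar>of_int (int l) * \<alpha> - of_int t\<bar>" for t
  proof (rule separation)
    have "2 * ((q + 1) div 2) \<le> q + 1" by simp
    thus "2 * \<bar>int l\<bar> < int q"
      using assms by linarith
  qed (use assms in auto)
  note b = bin_bounds[OF q_ge_1, of "real l * \<alpha>"]
  have "1 < 2 * real q * frac (real l * \<alpha>)"
    using s[of "\<lfloor>real l * \<alpha>\<rfloor>"] q frac_ge_0[of "real l * \<alpha>"] by (simp add: frac_def field_simps)
  thus "bin_index q (real l * \<alpha>) \<noteq> 0" using b by auto
  have "1 < 2 * real q * (1 - frac (real l * \<alpha>))"
    using s[of "\<lfloor>real l * \<alpha>\<rfloor> + 1"] q frac_lt_1[of "real l * \<alpha>"] by (simp add: frac_def field_simps)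
  hence "2 * real q * frac (real l * \<alpha>) < 2 * real q - 1" by (simp add: algebra_simps)
  hence "real (bin_index q (real l * \<alpha>)) < 2 * real q - 1" using b by linarith
  thus "bin_index q (real l * \<alpha>) \<noteq> 2 * q - 1" using q_ge_1 by (auto simp: of_nat_diff)
qed

lemma sum_bins_le:
  assumes "Z \<ge> 0"
  shows "(\<Sum>k<2*q. if k = 0 \<or> k = 2 * q - 1 then Z else real q / real k + real q / (2 * real q - 1 - real k))
           \<le> 2 * Z + 2 * q * harm (2 * q)"
proof -
  let ?I = "{1..<2*q-1}"
  have I_subset: "{Suc 0..<2 * q - Suc 0} \<subseteq> {..<2 * q}" by auto
  have "(\<Sum>k<2*q. if k = 0 \<or> k = 2 * q - 1 then Z else real q / real k + real q / (2 * real q - 1 - real k))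
      \<le> (\<Sum>k<2*q. (if k = 0 then Z else 0) + (if k = 2*q-1 then Z else 0) +
           (if k \<in> ?I then real q / real k + real q / (2 * real q - 1 - real k) else 0))"
    using assms by (intro sum_mono) auto
  also have "\<dots> = 2 * Z + (\<Sum>k\<in>?I. real q / real k + real q / (2 * real q - 1 - real k))"
    using q_ge_1
    by (simp add: sum.distrib sum.If_cases Int_absorb1 I_subset del: atLeastLessThan_iff)
  also have "(\<Sum>k\<in>?I. real q / real k + real q / (2 * real q - 1 - real k)) = 2 * (\<Sum>k\<in>?I. real q / k)"
  proof -
    have "(\<Sum>k\<in>?I. real q / (2 * real q - 1 - real k)) = (\<Sum>k\<in>?I. real q / k)"
      by (rule sum.reindex_bij_witness[of _ "\<lambda>k. 2 * q - 1 - k" "\<lambda>k. 2 * q - 1 - k"]) (auto simp: of_nat_diff)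
    thus ?thesis by (simp add: sum.distrib)
  qed
  also have "(\<Sum>k\<in>?I. real q / k) \<le> (\<Sum>k\<in>{1..2*q}. real q / k)"
    by (intro sum_mono2) auto
  also have "\<dots> = q * harm (2 * q)"
    by (simp add: harm_def sum_distrib_left divide_inverse)
  finally show ?thesis by simp
qed

text \<open>Injectivity turns the sum over \<open>l\<close> into a sum over arcs. The cap
  \<open>Z\<close> is demanded only on the two end arcs, so that it may be taken as 0 for the first
  block.\<close>

lemma block_sum_le:
  assumes "Z \<ge> 0" "I \<subseteq> {l0..<l0 + (q + 1) div 2}"
    and Y: "\<And>l. l \<in> I \<Longrightarrow> bin_index q (real l * \<alpha>) = 0 \<or> bin_index q (real l * \<alpha>) = 2 * q - 1 \<Longrightarrow> Y l \<le> Z"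
  shows "(\<Sum>l\<in>I. geom_bound (Y l) (real l * \<alpha>)) \<le> 2 * Z + 2 * q * harm (2 * q)"
proof -
  define G where "G k = (if k = 0 \<or> k = 2 * q - 1 then Z else real q / real k + real q / (2 * real q - 1 - real k))" for k :: nat
  have "geom_bound (Y l) (real l * \<alpha>) \<le> G (bin_index q (real l * \<alpha>))" if "l \<in> I" for l
    using Y[OF that] geom_bound_le[of "Y l" "real l * \<alpha>"] geom_bound_le_bin[OF q_ge_1, of "real l * \<alpha>" "Y l"]
    by (auto simp: G_def)
  hence "(\<Sum>l\<in>I. geom_bound (Y l) (real l * \<alpha>)) \<le> (\<Sum>l\<in>I. G (bin_index q (real l * \<alpha>)))"
    by (rule sum_mono)
  also have "\<dots> = (\<Sum>k\<in>(\<lambda>l. bin_index q (real l * \<alpha>)) ` I. G k)"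
    using inj_on_subset[OF inj_on_bin assms(2)] by (simp add: sum.reindex)
  also have "\<dots> \<le> (\<Sum>k<2*q. G k)"
  proof (rule sum_mono2)
    show "(\<lambda>l. bin_index q (real l * \<alpha>)) ` I \<subseteq> {..<2*q}"
      using bin_bounds(3)[OF q_ge_1] by auto
    fix k assume "k \<in> {..<2*q} - (\<lambda>l. bin_index q (real l * \<alpha>)) ` I"
    hence "real k \<le> 2 * real q - 1" by auto
    thus "0 \<le> G k" using assms(1) by (auto simp: G_def)
  qed auto
  also have "\<dots> \<le> 2 * Z + 2 * q * harm (2 * q)"
    unfolding G_def using assms(1) by (rule sum_bins_le)
  finally show ?thesis .
qed

text \<open>The range is cut into blocks of length \<open>h\<close>, about \<open>q / 2\<close>. In
  block \<open>j > 0\<close> every \<open>l\<close> is at least \<open>j * h\<close>, so the caps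
  add up to a harmonic sum; in addition each of the \<open>L div h + 1\<close> blocks costs
  \<open>q\<close> times a logarithm.\<close>

lemma vinogradov_sum:
  assumes Z: "Z \<ge> 0" and H: "harm (2 * q) \<le> H" "harm L \<le> H"
  shows "(\<Sum>l=1..L. geom_bound (Z / real l) (real l * \<alpha>)) \<le> 4 * H * (Z / q + L + q)"
proof -
  define h where "h = (q + 1) div 2"
  have h: "h > 0" "real q \<le> 2 * real h" using q_ge_1 unfolding h_def by linarith+
  define B where "B j = {l\<in>{1..L}. l div h = j}" for j
  have hl: "0 \<le> (harm (2*q) :: real)" by (rule harm_nonneg)
  have B_iff: "l \<in> B j \<longleftrightarrow> l \<in> {1..L} \<and> j * h \<le> l \<and> l < j * h + h" for l j
  proof -
    have "l div h * h \<le> l" "l < l div h * h + h"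
      using h(1) dividend_less_div_times[of h l] by (auto simp: div_times_less_eq_dividend add.commute)
    moreover have "l div h = j" if "j * h \<le> l" "l < j * h + h"
      using that by (intro div_nat_eqI) (auto simp: mult.commute)
    ultimately show ?thesis by (auto simp: B_def)
  qed
  have "(\<Sum>l=1..L. geom_bound (Z / real l) (real l * \<alpha>))
      = (\<Sum>j\<le>L div h. \<Sum>l\<in>B j. geom_bound (Z / real l) (real l * \<alpha>))"
    unfolding B_def by (rule sum.group[symmetric]) (auto intro: div_le_mono)
  also have "\<dots> \<le> (\<Sum>j\<le>L div h. 2 * (if j = 0 then 0 else Z / (real j * h)) + 2 * q * harm (2 * q))"
  proof (rule sum_mono)
    fix j
    show "(\<Sum>l\<in>B j. geom_bound (Z / real l) (real l * \<alpha>))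
      \<le> 2 * (if j = 0 then 0 else Z / (real j * h)) + 2 * q * harm (2 * q)"
    proof (rule block_sum_le)
      show "B j \<subseteq> {j*h..<j*h + (q + 1) div 2}" by (auto simp: B_iff h_def)
      fix l assume l: "l \<in> B j" "bin_index q (real l * \<alpha>) = 0 \<or> bin_index q (real l * \<alpha>) = 2 * q - 1"
      have "j \<noteq> 0"
      proof
        assume "j = 0"
        hence "0 < l" "l < (q + 1) div 2" using l(1) unfolding B_iff h_def by auto
        from bin_small[OF this] l(2) show False by simp
      qed
      moreover have "real (j * h) \<le> real l" using l by (simp add: B_iff del: of_nat_mult)
      ultimately show "Z / real l \<le> (if j = 0 then 0 else Z / (real j * h))"
        using Z h l by (auto intro!: divide_left_mono mult_pos_pos simp: B_iff)
    qed (use Z in auto)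
  qed
  also have "\<dots> = 2 * (\<Sum>j=1..L div h. Z / (real j * h)) + (real (L div h) + 1) * (2 * q * harm (2 * q))"
  proof -
    have "{..L div h} = insert 0 {1..L div h}" by auto
    thus ?thesis by (simp add: sum.distrib sum_distrib_left)
  qed
  also have "(\<Sum>j=1..L div h. Z / (real j * h)) = Z / h * harm (L div h)"
    by (simp add: harm_def sum_distrib_left divide_inverse mult_ac)
  also have "\<dots> \<le> (2 * Z / q) * H"
  proof (intro mult_mono)
    show "Z / h \<le> 2 * Z / q" using h Z q_ge_1 mult_left_mono[OF h(2) Z] by (simp add: field_simps)
    show "harm (L div h) \<le> H" using assms(3) harm_mono[of "L div h" L, where ?'a = real] by simp
  qed (use Z in \<open>auto simp: harm_nonneg\<close>)
  also have "(real (L div h) + 1) * (2 * q * harm (2 * q)) \<le> (2 * L / q + 1) * (2 * q * H)"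
  proof (intro mult_mono)
    have "real (L div h) * real h \<le> L"
      by (metis div_times_less_eq_dividend of_nat_le_iff of_nat_mult)
    moreover have "real (L div h) * real q \<le> real (L div h) * (2 * real h)"
      using h by (intro mult_left_mono) auto
    ultimately show "real (L div h) + 1 \<le> 2 * L / q + 1"
      using q_ge_1 by (simp add: field_simps)
  qed (use assms hl in \<open>auto intro: mult_left_mono\<close>)
  also have "2 * (2 * Z / q * H) + (2 * L / q + 1) * (2 * q * H) = H * (4 * (Z / q) + 4 * L + 2 * q)"
    using q_ge_1 by (simp add: field_simps)
  also have "\<dots> \<le> 4 * H * (Z / q + L + q)"
    using assms hl by (simp add: algebra_simps)
  finally show ?thesis by simp
qed

end

section \<open>Divisor sums and separation of variables\<close>

lemma sum_pairs_le_sum_divisors: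
  fixes \<phi> :: "nat \<Rightarrow> real"
  assumes "\<And>l. \<phi> l \<ge> 0"
  shows "(\<Sum>r=1..R. \<Sum>d=1..D. \<phi> (r * d)) \<le> (\<Sum>l=1..R*D. real (card {d. d dvd l}) * \<phi> l)"
proof -
  let ?P = "{1..R} \<times> {1..D}"
  have "(\<Sum>r=1..R. \<Sum>d=1..D. \<phi> (r * d)) = (\<Sum>p\<in>?P. \<phi> (fst p * snd p))"
    by (simp add: sum.cartesian_product case_prod_beta)
  also have "\<dots> = (\<Sum>l=1..R*D. \<Sum>p\<in>{p\<in>?P. fst p * snd p = l}. \<phi> (fst p * snd p))"
    by (rule sum.group[symmetric]) (auto intro: mult_le_mono)
  also have "\<dots> = (\<Sum>l=1..R*D. real (card {p\<in>?P. fst p * snd p = l}) * \<phi> l)"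
    by (intro sum.cong) auto
  also have "\<dots> \<le> (\<Sum>l=1..R*D. real (card {d. d dvd l}) * \<phi> l)"
  proof (intro sum_mono mult_right_mono)
    fix l assume l: "l \<in> {1..R*D}"
    have "card {p\<in>?P. fst p * snd p = l} \<le> card {d. d dvd l}"
    proof (rule card_inj_on_le[of snd])
      show "inj_on snd {p\<in>?P. fst p * snd p = l}"
        by (auto simp: inj_on_def)
    qed (use l in auto)
    thus "real (card {p\<in>?P. fst p * snd p = l}) \<le> real (card {d. d dvd l})" by simp
  qed (use assms in auto)
  finally show ?thesis .
qed

text \<open>Divisors \<open>d, e\<close> of \<open>l\<close> yield the factorisation \<open>l = g d' e' k\<close> with \<open>g = gcd d e\<close>,
  \<open>d = g d'\<close>, \<open>e = g e'\<close>.\<close>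

lemma sum_divisor_count_sq_le:
  "(\<Sum>l=1..L. (real (card {d. d dvd l}))\<^sup>2 / real l) \<le> harm L ^ 4"
proof -
  let ?T = "{1..L} \<times> {1..L} \<times> {1..L} \<times> {1..L}"
  define S where "S = (SIGMA l:{1..L}. {d. d dvd l} \<times> {e. e dvd l})"
  have fin: "finite {d::nat. d dvd l}" if "l \<in> {1..L}" for l using that by auto
  have "(\<Sum>l=1..L. (real (card {d. d dvd l}))\<^sup>2 / real l)
      = (\<Sum>l=1..L. \<Sum>p\<in>{d. d dvd l} \<times> {e. e dvd l}. 1 / real l)"
    by (simp add: card_cartesian_product power2_eq_square)
  also have "\<dots> = (\<Sum>(l,p)\<in>S. 1 / real l)"
    unfolding S_def by (rule sum.Sigma) (auto intro: fin)
  also have "\<dots> \<le> (\<Sum>(g,d,e,k)\<in>?T. 1 / real g * (1 / real d * (1 / real e * (1 / real k))))"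
  proof (rule sum_le_included[where i = "\<lambda>(g,d,e,k). (g*d*e*k, g*d, g*e)"])
    show "finite S" unfolding S_def by (intro finite_SigmaI) (auto intro: fin)
    show "\<forall>x\<in>S. \<exists>y\<in>?T. (case y of (g,d,e,k) \<Rightarrow> (g*d*e*k, g*d, g*e)) = x \<and>
        (case x of (l,p) \<Rightarrow> 1 / real l) \<le> (case y of (g,d,e,k) \<Rightarrow> 1 / real g * (1 / real d * (1 / real e * (1 / real k))))"
    proof
      fix x assume "x \<in> S"
      then obtain l d e where x: "x = (l, d, e)" "l \<in> {1..L}" "d dvd l" "e dvd l"
        by (auto simp: S_def)
      define g where "g = gcd d e"
      have l: "l > 0" "l \<le> L" using x by auto
      have "g > 0" unfolding g_def using x l by (auto intro!: Nat.gr0I)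
      obtain d' e' where de: "d = g * d'" "e = g * e'" "coprime d' e'"
        using gcd_coprime_exists[of d e] \<open>g > 0\<close> unfolding g_def by (auto simp: mult.commute)
      obtain m where m: "l = g * m" using x de by (metis dvd_def mult.assoc)
      have "d' dvd m" "e' dvd m" using x de m \<open>g > 0\<close> by auto
      hence "d' * e' dvd m" using de(3) by (simp add: divides_mult)
      then obtain k where k: "m = d' * e' * k" by blast
      have lk: "l = g * d' * e' * k" using m k by (simp add: mult_ac)
      have "g dvd l" "d' dvd l" "e' dvd l" "k dvd l" unfolding lk by simp_all
      hence "g \<le> L" "d' \<le> L" "e' \<le> L" "k \<le> L" using l by (meson dvd_imp_le le_trans)+
      moreover have "g > 0" "d' > 0" "e' > 0" "k > 0" using l lk by (auto intro: Nat.gr0I)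
      ultimately have "(g, d', e', k) \<in> ?T" by auto
      moreover have "1 / real l = 1 / real g * (1 / real d' * (1 / real e' * (1 / real k)))"
        unfolding lk by simp
      ultimately show "\<exists>y\<in>?T. (case y of (g,d,e,k) \<Rightarrow> (g*d*e*k, g*d, g*e)) = x \<and>
        (case x of (l,p) \<Rightarrow> 1 / real l) \<le> (case y of (g,d,e,k) \<Rightarrow> 1 / real g * (1 / real d * (1 / real e * (1 / real k))))"
        using x lk de by (intro bexI[of _ "(g, d', e', k)"]) auto
    qed
  qed auto
  also have "\<dots> = (\<Sum>g=1..L. 1 / real g) * ((\<Sum>g=1..L. 1 / real g) * ((\<Sum>g=1..L. 1 / real g) * (\<Sum>g=1..L. 1 / real g)))"
    by (simp only: sum_product sum.cartesian_product) (simp add: case_prod_beta)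
  also have "\<dots> = harm L ^ 4"
    by (simp add: harm_def power4_eq_xxxx inverse_eq_divide)
  finally show ?thesis .
qed

lemma sum_mult_le_sqrt:
  fixes f g :: "'a \<Rightarrow> real"
  shows "(\<Sum>x\<in>A. f x * g x) \<le> sqrt (\<Sum>x\<in>A. (f x)\<^sup>2) * sqrt (\<Sum>x\<in>A. (g x)\<^sup>2)"
proof -
  have "(\<Sum>x\<in>A. f x * g x) \<le> sqrt ((\<Sum>x\<in>A. (f x)\<^sup>2) * (\<Sum>x\<in>A. (g x)\<^sup>2))"
    by (rule real_le_rsqrt) (rule Cauchy_Schwarz_ineq_sum)
  thus ?thesis by (simp add: real_sqrt_mult)
qed

section \<open>Finite Fourier analysis modulo \<open>2 * Q\<close>\<close>

lemma e_char_eq_1_iff: "e_char x = 1 \<longleftrightarrow> x \<in> \<int>"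
proof
  assume "e_char x = 1"
  hence "cos (2 * pi * x) = 1"
    by (simp add: e_char_eq_cis complex_eq_iff)
  then obtain n :: int where "2 * pi * x = of_int n * 2 * pi"
    using cos_one_2pi_int by blast
  hence "x = of_int n" by simp
  thus "x \<in> \<int>" by simp
qed (auto elim: Ints_cases)

lemma sum_e_char_complete:
  fixes k :: int
  assumes "n > 0"
  shows "(\<Sum>t<n. e_char (real t * (of_int k / real n))) = (if int n dvd k then of_nat n else 0)"
proof (cases "int n dvd k")
  case True
  then obtain j where "k = int n * j" by blast
  hence "of_int k / real n = of_int j" using assms by simp
  thus ?thesis using True by (simp add: e_char_of_nat_mult)
next
  case False
  have "e_char (of_int k / real n) \<noteq> 1"
  proof
    assume "e_char (of_int k / real n) = 1"
    then obtain j where "of_int k / real n = of_int j"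
      unfolding e_char_eq_1_iff by (auto elim: Ints_cases)
    hence "real_of_int k = of_int (j * int n)" using assms by (simp add: field_simps)
    hence "k = j * int n" by (simp only: of_int_eq_iff)
    thus False using False by simp
  qed
  moreover have "e_char (of_int k / real n) ^ n = 1"
    using assms by (simp flip: e_char_of_nat_mult)
  ultimately show ?thesis
    using False geometric_sum[of "e_char (of_int k / real n)" n]
    by (simp add: e_char_of_nat_mult del: times_divide_eq_right)
qed

text \<open>For \<open>a, b < Q\<close>, the inequality \<open>a \<le> b\<close> means that
  \<open>b - a\<close> is some \<open>s < Q\<close>. As \<open>b - a - s\<close> is smaller than
  \<open>2 * Q\<close> in absolute value, the modulus \<open>2 * Q\<close> detects this without
  wrap-around. The coefficients are normalised geometric sums bounded by a multiple of
  \<open>1 / t + 1 / (2 * Q - t)\<close>, whence the logarithmic l1 norm.\<close>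

lemma le_indicator_fourier:
  assumes Q: "Q \<ge> 1"
  obtains c :: "nat \<Rightarrow> complex" where
    "(\<Sum>t<2*Q. cmod (c t)) \<le> 1 + harm (2 * Q)"
    "\<And>a b. a < Q \<Longrightarrow> b < Q \<Longrightarrow> of_bool (a \<le> b) =
       (\<Sum>t<2*Q. c t * (e_char (- (real t * (real a / real (2 * Q)))) * e_char (real t * (real b / real (2 * Q)))))"
proof -
  define c where "c t = (\<Sum>s<Q. e_char (real s * - (real t / real (2*Q)))) / of_nat (2 * Q)" for t
  have "of_bool (a \<le> b) = (\<Sum>t<2*Q. c t * (e_char (- (real t * (real a / real (2 * Q)))) * e_char (real t * (real b / real (2 * Q)))))"
    if ab: "a < Q" "b < Q" for a b
  proof -
    have "(\<Sum>t<2*Q. c t * (e_char (- (real t * (real a / real (2 * Q)))) * e_char (real t * (real b / real (2 * Q)))))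
      = (\<Sum>t<2*Q. \<Sum>s<Q. e_char (real t * (of_int (int b - int a - int s) / real (2*Q))) / of_nat (2*Q))"
    proof (intro sum.cong refl)
      fix t
      have "e_char (real s * - (real t / real (2*Q))) * (e_char (- (real t * (real a / real (2 * Q)))) * e_char (real t * (real b / real (2 * Q))))
        = e_char (real t * (of_int (int b - int a - int s) / real (2*Q)))" for s
      proof -
        have "real t * (of_int (int b - int a - int s) / real (2*Q)) =
           real s * - (real t / real (2*Q)) + (- (real t * (real a / real (2 * Q))) + real t * (real b / real (2 * Q)))"
          using Q by (simp add: field_simps)
        thus ?thesis by (simp only: e_char_add)
      qed
      thus "c t * (e_char (- (real t * (real a / real (2 * Q)))) * e_char (real t * (real b / real (2 * Q))))
        = (\<Sum>s<Q. e_char (real t * (of_int (int b - int a - int s) / real (2*Q))) / of_nat (2*Q))"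
        by (simp only: c_def times_divide_eq_left sum_distrib_right sum_divide_distrib)
    qed
    also have "\<dots> = (\<Sum>s<Q. (\<Sum>t<2*Q. e_char (real t * (of_int (int b - int a - int s) / real (2*Q)))) / of_nat (2*Q))"
      by (subst sum.swap) (simp only: sum_divide_distrib)
    also have "\<dots> = (\<Sum>s<Q. if s = b - a \<and> a \<le> b then 1 else 0)"
    proof (intro sum.cong refl)
      fix s assume s: "s \<in> {..<Q}"
      have "int (2*Q) dvd int b - int a - int s \<longleftrightarrow> s = b - a \<and> a \<le> b"
      proof
        assume "int (2*Q) dvd int b - int a - int s"
        moreover have "\<bar>int b - int a - int s\<bar> < int (2*Q)" using ab s by auto
        ultimately have "int b - int a - int s = 0" using zdvd_not_zless[of "\<bar>int b - int a - int s\<bar>" "int (2*Q)"] by auto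
        thus "s = b - a \<and> a \<le> b" by auto
      qed (auto simp: of_nat_diff)
      thus "(\<Sum>t<2*Q. e_char (real t * (of_int (int b - int a - int s) / real (2*Q)))) / of_nat (2*Q)
        = (if s = b - a \<and> a \<le> b then 1 else 0)"
        using sum_e_char_complete[of "2*Q" "int b - int a - int s"] Q by (simp del: of_int_diff of_nat_mult)
    qed
    also have "\<dots> = of_bool (a \<le> b)"
      using ab by (cases "a \<le> b") auto
    finally show ?thesis by simp
  qed
  moreover have "(\<Sum>t<2*Q. cmod (c t)) \<le> 1 + harm (2 * Q)"
  proof -
    have c0: "cmod (c 0) \<le> 1" using Q by (simp add: c_def norm_divide)
    have ct: "cmod (c t) \<le> (1 / real t + 1 / (2 * real Q - real t)) / 2" if t: "t \<in> {1..<2*Q}" for t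
    proof -
      define y where "y = real t / real (2 * Q)"
      have y: "0 < y" "y < 1" using t Q by (auto simp: y_def field_simps)
      have s: "sin (pi * y) > 0" using y by (intro sin_gt_zero) auto
      have ty: "2 * real Q > real t" "real t > 0" using t by auto
      have "cmod (\<Sum>s<Q. e_char (real s * - y)) \<le> geom_bound Q y"
        using norm_geom_sum_le[where n = Q and x = "- y"] by (simp add: geom_bound_uminus)
      also have "\<dots> \<le> 1 / sin (pi * y)"
        using s norm_e_char_diff_1[of y] by (auto simp: geom_bound_def)
      also have "\<dots> \<le> 1 / (2 * y) + 1 / (2 * (1 - y))" by (rule inverse_sin_pi_le[OF y])
      also have "\<dots> = (1 / real t + 1 / (2 * real Q - real t)) * Q"
        using ty Q unfolding y_def by (simp add: field_simps)
      finally have "cmod (\<Sum>s<Q. e_char (real s * - y)) / real (2 * Q) \<le> (1 / real t + 1 / (2 * real Q - real t)) * Q / real (2 * Q)"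
        by (intro divide_right_mono) auto
      also have "(1 / real t + 1 / (2 * real Q - real t)) * Q / real (2 * Q) = (1 / real t + 1 / (2 * real Q - real t)) / 2"
        using Q by simp
      finally show ?thesis by (simp add: c_def y_def norm_divide norm_mult)
    qed
    have "(\<Sum>t<2*Q. cmod (c t)) = cmod (c 0) + (\<Sum>t\<in>{1..<2*Q}. cmod (c t))"
    proof -
      have "{..<2*Q} = insert 0 {1..<2*Q}" using Q by auto
      thus ?thesis by simp
    qed
    also have "\<dots> \<le> 1 + (\<Sum>t\<in>{1..<2*Q}. (1 / real t + 1 / (2 * real Q - real t)) / 2)"
      by (intro add_mono c0 sum_mono ct)
    also have "(\<Sum>t\<in>{1..<2*Q}. (1 / real t + 1 / (2 * real Q - real t)) / 2)
       = ((\<Sum>t\<in>{1..<2*Q}. 1 / real t) + (\<Sum>t\<in>{1..<2*Q}. 1 / (2 * real Q - real t))) / 2"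
      by (simp add: sum.distrib flip: sum_divide_distrib)
    also have "(\<Sum>t\<in>{1..<2*Q}. 1 / (2 * real Q - real t)) = (\<Sum>t\<in>{1..<2*Q}. 1 / real t)"
      by (rule sum.reindex_bij_witness[of _ "\<lambda>t. 2*Q - t" "\<lambda>t. 2*Q - t"]) (auto simp: of_nat_diff)
    also have "((\<Sum>t\<in>{1..<2*Q}. 1 / real t) + (\<Sum>t\<in>{1..<2*Q}. 1 / real t)) / 2 \<le> harm (2 * Q)"
      unfolding harm_def by (auto simp: inverse_eq_divide intro!: sum_mono2)
    finally show ?thesis by simp
  qed
  ultimately show ?thesis using that[of c] by blast
qed

text \<open>The Fourier phases have modulus 1 and are absorbed into the coefficients, so the
  hypothesis on \<open>E\<close>, uniform in the coefficients, applies at every frequency. The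
  conclusion is again uniform in \<open>A\<close> and \<open>B\<close>, which allows a second
  application to a further condition.\<close>

lemma separation_of_variables:
  fixes K :: "'a \<Rightarrow> 'b \<Rightarrow> 'c \<Rightarrow> complex" and f :: "'b \<Rightarrow> nat" and g :: "'c \<Rightarrow> nat"
  assumes Q: "Q \<ge> 1" and f: "\<And>u. u \<in> J \<Longrightarrow> f u < Q" and g: "\<And>w. w \<in> M \<Longrightarrow> g w < Q"
    and E: "\<And>A B. (\<And>u. cmod (A u) \<le> 1) \<Longrightarrow> (\<And>w. cmod (B w) \<le> 1) \<Longrightarrow>
          (\<Sum>r\<in>I. cmod (\<Sum>u\<in>J. \<Sum>w\<in>M. A u * B w * K r u w)) \<le> E"
    and A: "\<And>u. cmod (A u) \<le> 1" and B: "\<And>w. cmod (B w) \<le> 1"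
  shows "(\<Sum>r\<in>I. cmod (\<Sum>u\<in>J. \<Sum>w\<in>M. A u * B w * (of_bool (f u \<le> g w) * K r u w)))
           \<le> (1 + harm (2 * Q)) * E"
proof -
  obtain c where c: "(\<Sum>t<2*Q. cmod (c t)) \<le> 1 + harm (2 * Q)"
    "\<And>a b. a < Q \<Longrightarrow> b < Q \<Longrightarrow> of_bool (a \<le> b) =
       (\<Sum>t<2*Q. c t * (e_char (- (real t * (real a / real (2 * Q)))) * e_char (real t * (real b / real (2 * Q)))))"
    using le_indicator_fourier[OF Q] by blast
  define A' where "A' t u = A u * e_char (- (real t * (real (f u) / real (2 * Q))))" for t u
  define B' where "B' t w = B w * e_char (real t * (real (g w) / real (2 * Q)))" for t w
  have "0 \<le> (\<Sum>r\<in>I. cmod (\<Sum>u\<in>J. \<Sum>w\<in>M. 0 * 0 * K r u w))" by (intro sum_nonneg) auto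
  also have "\<dots> \<le> E" by (rule E) auto
  finally have E0: "E \<ge> 0" .
  have eq: "(\<Sum>u\<in>J. \<Sum>w\<in>M. A u * B w * (of_bool (f u \<le> g w) * K r u w))
      = (\<Sum>t<2*Q. c t * (\<Sum>u\<in>J. \<Sum>w\<in>M. A' t u * B' t w * K r u w))" for r
  proof -
    have "(\<Sum>u\<in>J. \<Sum>w\<in>M. A u * B w * (of_bool (f u \<le> g w) * K r u w))
       = (\<Sum>u\<in>J. \<Sum>w\<in>M. \<Sum>t<2*Q. c t * (A' t u * B' t w * K r u w))"
    proof (intro sum.cong refl)
      fix u w assume "u \<in> J" "w \<in> M"
      hence "of_bool (f u \<le> g w) = (\<Sum>t<2*Q. c t * (e_char (- (real t * (real (f u) / real (2 * Q)))) * e_char (real t * (real (g w) / real (2 * Q)))))"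
        by (intro c(2) f g)
      thus "A u * B w * (of_bool (f u \<le> g w) * K r u w) = (\<Sum>t<2*Q. c t * (A' t u * B' t w * K r u w))"
        by (simp only: sum_distrib_left sum_distrib_right A'_def B'_def mult_ac)
    qed
    also have "\<dots> = (\<Sum>u\<in>J. \<Sum>t<2*Q. \<Sum>w\<in>M. c t * (A' t u * B' t w * K r u w))"
      by (intro sum.cong refl sum.swap)
    also have "\<dots> = (\<Sum>t<2*Q. \<Sum>u\<in>J. \<Sum>w\<in>M. c t * (A' t u * B' t w * K r u w))"
      by (rule sum.swap)
    finally show ?thesis by (simp only: sum_distrib_left)
  qed
  have "(\<Sum>r\<in>I. cmod (\<Sum>u\<in>J. \<Sum>w\<in>M. A u * B w * (of_bool (f u \<le> g w) * K r u w)))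
     \<le> (\<Sum>r\<in>I. \<Sum>t<2*Q. cmod (c t) * cmod (\<Sum>u\<in>J. \<Sum>w\<in>M. A' t u * B' t w * K r u w))"
    unfolding eq by (intro sum_mono sum_norm_le) (simp add: norm_mult)
  also have "\<dots> = (\<Sum>t<2*Q. cmod (c t) * (\<Sum>r\<in>I. cmod (\<Sum>u\<in>J. \<Sum>w\<in>M. A' t u * B' t w * K r u w)))"
    by (subst sum.swap) (simp only: sum_distrib_left)
  also have "\<dots> \<le> (\<Sum>t<2*Q. cmod (c t) * E)"
    by (intro sum_mono mult_left_mono E) (auto simp: A'_def B'_def norm_mult A B)
  also have "\<dots> \<le> (1 + harm (2 * Q)) * E"
    unfolding sum_distrib_right[symmetric] using c(1) E0 by (rule mult_right_mono)
  finally show ?thesis .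
qed

section \<open>Sums of two coprime squares\<close>

lemma QuadRes_minus_one_iff:
  fixes p :: nat
  assumes p: "prime p" "odd p"
  shows "QuadRes p (-1) \<longleftrightarrow> p mod 4 = 1"
proof -
  have p2: "2 < p" using p prime_ge_2_nat[of p] by (cases "p = 2") auto
  have L: "[Legendre (-1) p = (-1) ^ ((p - 1) div 2)] (mod p)"
    using euler_criterion[OF p(1) p2] .
  have n0: "\<not> [-1 = 0] (mod int p)"
    using p2 by (auto simp: cong_0_iff)
  have ne: "\<not> [1 = -1] (mod int p)" "\<not> [-1 = 1] (mod int p)"
    using p2 zdvd_not_zless[of 2 "int p"] by (auto simp: cong_iff_dvd_diff)
  have "p mod 4 = 1 \<or> p mod 4 = 3" using p(2) by presburger
  thus ?thesis
  proof
    assume m: "p mod 4 = 1"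
    hence "even ((p - 1) div 2)" by presburger
    thus ?thesis using L n0 ne m by (auto simp: Legendre_def split: if_splits)
  next
    assume m: "p mod 4 = 3"
    hence "odd ((p - 1) div 2)" by presburger
    thus ?thesis using L n0 ne m by (auto simp: Legendre_def split: if_splits)
  qed
qed

text \<open>Coprimality makes \<open>y\<close> invertible modulo \<open>p\<close>, and
  \<open>x\<close> divided by \<open>y\<close> would be a square root of -1.\<close>

lemma prime_3_mod_4_not_dvd_sum_squares:
  fixes x y :: int and p :: nat
  assumes "coprime x y" "prime p" "p mod 4 = 3"
  shows "\<not> int p dvd x\<^sup>2 + y\<^sup>2"
proof
  assume dvd: "int p dvd x\<^sup>2 + y\<^sup>2"
  have pp: "prime (int p)" using assms by simp
  have "odd p" using assms by presburger
  have "\<not> int p dvd y"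
  proof
    assume y: "int p dvd y"
    hence "int p dvd x\<^sup>2" using dvd by (simp add: dvd_add_left_iff power2_eq_square)
    hence "int p dvd x" using pp by (simp add: prime_dvd_power_iff)
    with y show False using assms(1) pp by (meson coprime_common_divisor not_prime_unit)
  qed
  hence "coprime y (int p)" using pp prime_imp_coprime coprime_commute by blast
  then obtain z where z: "[y * z = 1] (mod int p)" using cong_solve_coprime_int by blast
  have "[(x * z)\<^sup>2 = -1] (mod int p)"
  proof -
    have "[(x * z)\<^sup>2 = (x\<^sup>2 + y\<^sup>2) * z\<^sup>2 - (y * z)\<^sup>2] (mod int p)"
      by (simp add: algebra_simps)
    also have "[(x\<^sup>2 + y\<^sup>2) * z\<^sup>2 - (y * z)\<^sup>2 = 0 * z\<^sup>2 - 1\<^sup>2] (mod int p)"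
      using dvd z by (intro cong_diff cong_mult cong_pow cong_refl) (auto simp: cong_0_iff)
    finally show ?thesis by simp
  qed
  hence "QuadRes p (-1)" by (auto simp: QuadRes_def)
  thus False using QuadRes_minus_one_iff[of p] assms \<open>odd p\<close> by simp
qed

text \<open>Induction strips one prime \<open>p\<close> at a time: a root modulo the cofactor
  \<open>m\<close> is lifted by Hensel's method if \<open>p\<close> divides \<open>m\<close>, and
  glued to a root modulo \<open>p\<close> by the Chinese remainder theorem otherwise.\<close>

lemma sqrt_minus_one_mod:
  fixes n :: nat
  assumes "n > 0" "odd n" "\<And>p. prime p \<Longrightarrow> p mod 4 = 3 \<Longrightarrow> \<not> p dvd n"
  shows "\<exists>x::int. int n dvd x\<^sup>2 + 1"
  using assms
proof (induction n rule: less_induct)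
  case (less n)
  show ?case
  proof (cases "n = 1")
    case True
    thus ?thesis by simp
  next
    case False
    obtain p where p: "prime p" "p dvd n" using prime_factor_nat[OF False] by blast
    then obtain m where n: "n = p * m" by blast
    have op: "odd p" "odd m" using less.prems n by auto
    have p4: "p mod 4 = 1"
    proof -
      have "p mod 4 \<noteq> 3" using less.prems(3)[OF p(1)] p(2) by blast
      thus ?thesis using op by presburger
    qed
    have "m < n" "m > 0" using n less.prems prime_gt_1_nat[OF p(1)] by (auto intro!: Nat.gr0I)
    moreover have "\<not> r dvd m" if "prime r" "r mod 4 = 3" for r
      using less.prems(3)[OF that] n by (meson dvd_mult)
    ultimately obtain x where x: "int m dvd x\<^sup>2 + 1" using less.IH[of m] op by blast
    have pp: "prime (int p)" using p by simp
    show ?thesis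
    proof (cases "p dvd m")
      case True
      obtain c where c: "x\<^sup>2 + 1 = int m * c" using x by blast
      have "int p dvd x\<^sup>2 + 1" using True x by (meson dvd_trans int_dvd_int_iff)
      hence "\<not> int p dvd x"
        using pp by (metis dvd_add_right_iff dvd_mult power2_eq_square not_prime_unit)
      moreover have "\<not> int p dvd 2"
      proof
        assume "int p dvd 2"
        hence "int p \<le> 2" by (rule zdvd_imp_le) simp
        thus False using prime_ge_2_nat[OF p(1)] op by (cases "p = 2") auto
      qed
      ultimately have "coprime (2 * x) (int p)"
        using pp by (metis coprime_commute prime_dvd_mult_iff prime_imp_coprime)
      then obtain z where z: "[2 * x * z = 1] (mod int p)" using cong_solve_coprime_int by blast
      \<comment> \<open>Replacing \<open>x\<close> by \<open>x + k * int m\<close> changes the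
        quotient \<open>c\<close> into \<open>c + 2 * x * k + k\<^sup>2 * int m\<close>. This
        \<open>k\<close> makes the first two summands cancel modulo \<open>p\<close>, and the third
        vanishes because \<open>p\<close> divides \<open>m\<close>.\<close>
      define k where "k = - c * z"
      have "[2 * x * z * (- c) = 1 * (- c)] (mod int p)" by (intro cong_mult z cong_refl)
      hence 1: "[2 * x * k = - c] (mod int p)" by (simp add: k_def mult_ac)
      have 2: "[int m = 0] (mod int p)" using True by (simp add: cong_0_iff)
      have "[c + 2 * x * k + k\<^sup>2 * int m = c + (- c) + k\<^sup>2 * 0] (mod int p)"
        by (rule cong_add[OF cong_add[OF cong_refl 1] cong_mult[OF cong_refl 2]])
      hence "int p dvd c + 2 * x * k + k\<^sup>2 * int m" by (simp add: cong_0_iff)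
      hence "int m * int p dvd int m * (c + 2 * x * k + k\<^sup>2 * int m)" by (rule mult_dvd_mono[OF dvd_refl])
      also have "int m * (c + 2 * x * k + k\<^sup>2 * int m) = (x + k * int m)\<^sup>2 + 1"
        using c by (simp add: power2_eq_square algebra_simps)
      finally show ?thesis unfolding n by (auto simp: mult.commute)
    next
      case False
      obtain y where y: "[y\<^sup>2 = -1] (mod int p)"
        using QuadRes_minus_one_iff[OF p(1) op(1)] p4 by (auto simp: QuadRes_def)
      have cop: "coprime (int p) (int m)" using False p by (simp add: prime_imp_coprime)
      obtain w where w: "[w = y] (mod int p)" "[w = x] (mod int m)"
        using binary_chinese_remainder_int[OF cop] by blast
      have "[w\<^sup>2 + 1 = y\<^sup>2 + 1] (mod int p)" by (intro cong_add cong_pow w cong_refl)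
      also have "[y\<^sup>2 + 1 = -1 + 1] (mod int p)" by (intro cong_add y cong_refl)
      finally have 1: "int p dvd w\<^sup>2 + 1" by (simp add: cong_0_iff)
      have "[w\<^sup>2 + 1 = x\<^sup>2 + 1] (mod int m)" by (intro cong_add cong_pow w cong_refl)
      hence 2: "int m dvd w\<^sup>2 + 1" using x by (simp add: cong_dvd_iff)
      from 1 2 cop have "int p * int m dvd w\<^sup>2 + 1" by (rule divides_mult)
      thus ?thesis unfolding n by auto
    qed
  qed
qed

text \<open>Thue's argument: the box has more than \<open>n\<close> points, so two of them agree in
  \<open>u - x * v\<close> modulo \<open>n\<close>. Their difference gives a positive multiple of
  \<open>n\<close> that is at most \<open>2 * n\<close>, and it remains to exclude
  \<open>2 * n\<close>.\<close>

lemma thue_coprime_sum_squares: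
  fixes n :: nat and x :: int
  assumes "odd n" "int n dvd x\<^sup>2 + 1"
  shows "\<exists>u v :: int. coprime u v \<and> int n = u\<^sup>2 + v\<^sup>2"
proof (cases "n = 1")
  case True
  thus ?thesis by (intro exI[of _ 1] exI[of _ 0]) auto
next
  case False
  have n: "n > 0" using assms(1) by (auto intro: Nat.gr0I)
  define k where "k = floor_sqrt n"
  have k: "k\<^sup>2 \<le> n" "n < (Suc k)\<^sup>2"
    unfolding k_def by (auto simp: Suc_floor_sqrt_power2_gt)
  define \<phi> where "\<phi> = (\<lambda>(u::int, v). (u - x * v) mod int n)"
  let ?A = "{0..int k} \<times> {0..int k}"
  have "\<not> inj_on \<phi> ?A"
  proof
    assume "inj_on \<phi> ?A"
    moreover have "\<phi> ` ?A \<subseteq> {0..<int n}" using n by (auto simp: \<phi>_def)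
    ultimately have "card ?A \<le> card {0..<int n}" by (intro card_inj_on_le[of \<phi>]) auto
    moreover have "nat (int k + 1) = Suc k" by simp
    ultimately show False using k(2) by (simp add: card_cartesian_product power2_eq_square)
  qed
  then obtain u1 v1 u2 v2 where uv: "(u1, v1) \<in> ?A" "(u2, v2) \<in> ?A" "(u1, v1) \<noteq> (u2, v2)"
    "\<phi> (u1, v1) = \<phi> (u2, v2)"
    by (auto simp: inj_on_def)
  define u v where "u = u1 - u2" and "v = v1 - v2"
  have "int n dvd (u1 - x * v1) - (u2 - x * v2)"
    using uv(4) by (simp add: \<phi>_def mod_eq_dvd_iff)
  then obtain j where j: "u = x * v + int n * j"
    by (auto simp: u_def v_def dvd_def algebra_simps)
  obtain c where c: "x\<^sup>2 + 1 = int n * c" using assms(2) by blast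
  \<comment> \<open>The quotient of \<open>u\<^sup>2 + v\<^sup>2\<close> by \<open>n\<close>,
    arranged so that every common divisor of \<open>u\<close> and \<open>v\<close> visibly divides
    it; hence \<open>s = 1\<close> also yields coprimality.\<close>
  define s where "s = v * (v * c + x * j) + j * u"
  have "u\<^sup>2 + v\<^sup>2 = v\<^sup>2 * (x\<^sup>2 + 1) + int n * (2 * x * v * j + int n * j\<^sup>2)"
    unfolding j by (simp add: power2_eq_square algebra_simps)
  also have "\<dots> = int n * s"
    unfolding c s_def j by (simp add: power2_eq_square algebra_simps)
  finally have uvs: "u\<^sup>2 + v\<^sup>2 = int n * s" .
  have "u\<^sup>2 + v\<^sup>2 \<noteq> 0" using uv(3) by (auto simp: u_def v_def sum_power2_eq_zero_iff)
  hence "u\<^sup>2 + v\<^sup>2 > 0" by (simp add: sum_power2_gt_zero_iff)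
  hence s0: "s > 0" using uvs n by (simp add: zero_less_mult_iff)
  have abs: "\<bar>u\<bar> \<le> int k" "\<bar>v\<bar> \<le> int k" using uv by (auto simp: u_def v_def)
  hence sq: "u\<^sup>2 \<le> (int k)\<^sup>2" "v\<^sup>2 \<le> (int k)\<^sup>2" by (simp_all add: abs_le_square_iff[symmetric])
  have kn: "(int k)\<^sup>2 \<le> int n" using k(1) by (metis of_nat_le_iff of_nat_power)
  have "int n * s \<le> int n * 2" using sq kn uvs by linarith
  hence s2: "s \<le> 2" using n by simp
  have com: "d dvd s" if "d dvd u" "d dvd v" for d
    unfolding s_def using that by (intro dvd_add) auto
  \<comment> \<open>With \<open>s = 2\<close> all the bounds are attained:
    \<open>\<bar>u\<bar> = \<bar>v\<bar> = k\<close> and \<open>k\<^sup>2 = n\<close>. Then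
    \<open>k\<close> divides \<open>s\<close>, so \<open>n\<close> is 1 or 4, against
    \<open>n \<noteq> 1\<close> and \<open>n\<close> odd.\<close>
  have "s \<noteq> 2"
  proof
    assume "s = 2"
    hence "u\<^sup>2 + v\<^sup>2 = 2 * int n" using uvs by simp
    hence "u\<^sup>2 = (int k)\<^sup>2" "v\<^sup>2 = (int k)\<^sup>2" "(int k)\<^sup>2 = int n" using sq kn by linarith+
    hence "int k dvd u" "int k dvd v" "k\<^sup>2 = n"
      by (auto simp: power2_eq_iff)
    moreover from this have "int k dvd 2" using com \<open>s = 2\<close> by blast
    hence "k dvd 2" by (metis int_dvd_int_iff of_nat_numeral)
    hence "k = 1 \<or> k = 2" using two_is_prime_nat by (auto simp: prime_nat_iff)
    ultimately show False using assms(1) False by auto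
  qed
  hence "s = 1" using s0 s2 by linarith
  moreover from this have "coprime u v" using com by (auto intro: coprimeI)
  ultimately show ?thesis using uvs by (intro exI[of _ u] exI[of _ v]) auto
qed

lemma BB_iff:
  "n \<in> BB \<longleftrightarrow> n > 0 \<and> odd n \<and> (\<forall>p. prime p \<longrightarrow> p mod 4 = 3 \<longrightarrow> \<not> p dvd n)"
proof
  assume "n \<in> BB"
  then obtain x y :: int where n: "n > 0" "odd n" "coprime x y" "int n = x\<^sup>2 + y\<^sup>2"
    by (auto simp: BB_def)
  moreover have "\<not> p dvd n" if "prime p" "p mod 4 = 3" for p
    using prime_3_mod_4_not_dvd_sum_squares[OF n(3) that] n(4) by (metis int_dvd_int_iff)
  ultimately show "n > 0 \<and> odd n \<and> (\<forall>p. prime p \<longrightarrow> p mod 4 = 3 \<longrightarrow> \<not> p dvd n)" by blast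
next
  assume *: "n > 0 \<and> odd n \<and> (\<forall>p. prime p \<longrightarrow> p mod 4 = 3 \<longrightarrow> \<not> p dvd n)"
  then obtain x :: int where "int n dvd x\<^sup>2 + 1" using sqrt_minus_one_mod[of n] by blast
  thus "n \<in> BB" using thue_coprime_sum_squares[of n x] * by (simp add: BB_def)
qed

section \<open>Detecting \<open>BB\<close> with primes up to the square root\<close>

lemma exists_prime_3_mod_4:
  fixes m :: nat
  assumes "m mod 4 = 3"
  shows "\<exists>p. prime p \<and> p mod 4 = 3 \<and> p dvd m"
  using assms
proof (induction m rule: less_induct)
  case (less m)
  have "m \<noteq> 1" using less.prems by auto
  then obtain p where p: "prime p" "p dvd m" using prime_factor_nat by blast
  then obtain k where k: "m = p * k" by blast
  show ?case
  proof (cases "p mod 4 = 3")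
    case False
    have "odd m" using less.prems by presburger
    hence "odd p" using k by simp
    hence p1: "p mod 4 = 1" using False by presburger
    have "m mod 4 = (p mod 4) * k mod 4" unfolding k by (simp add: mod_mult_left_eq)
    hence k3: "k mod 4 = 3" using less.prems p1 by simp
    have "k < m" using k k3 prime_gt_1_nat[OF p(1)] by (cases "k = 0") auto
    from less.IH[OF this k3] show ?thesis using k by (metis dvd_mult)
  qed (use p in blast)
qed

definition sieve_primes :: "nat \<Rightarrow> nat set" where
  "sieve_primes N = {p. prime p \<and> p mod 4 = 3 \<and> p\<^sup>2 \<le> N}"


text \<open>A prime \<open>p\<close> congruent to 3 modulo 4 dividing \<open>n\<close> leaves a
  cofactor congruent to 3, which contains another such prime \<open>r\<close>, possibly equal to
  \<open>p\<close>. Since \<open>p * r \<le> n\<close>, the smaller of the two passes the sieve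
  limit.\<close>

lemma BB_iff_sieve:
  assumes "n mod 4 = 1" "n \<le> N"
  shows "n \<in> BB \<longleftrightarrow> prime_factors n \<inter> sieve_primes N = {}"
proof -
  have n: "n > 0" "odd n" using assms(1) by presburger+
  have "\<exists>p. prime p \<and> p mod 4 = 3 \<and> p dvd n \<and> p\<^sup>2 \<le> N" if p: "prime p" "p mod 4 = 3" "p dvd n" for p
  proof -
    obtain m where m: "n = p * m" using p by blast
    have "(p * m) mod 4 = ((p mod 4) * (m mod 4)) mod 4" by (simp add: mod_mult_eq)
    hence "(3 * (m mod 4)) mod 4 = 1" using assms(1) m p(2) by simp
    moreover have "m mod 4 \<in> {0, 1, 2, 3}" by auto
    ultimately have "m mod 4 = 3" by auto
    then obtain r where r: "prime r" "r mod 4 = 3" "r dvd m" using exists_prime_3_mod_4 by blast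
    have pr: "p * r \<le> n" using r m n by (intro dvd_imp_le) auto
    show ?thesis
    proof (cases "p \<le> r")
      case True
      hence "p\<^sup>2 \<le> p * r" by (simp add: power2_eq_square)
      thus ?thesis using p pr assms by (intro exI[of _ p]) auto
    next
      case False
      hence "r\<^sup>2 \<le> p * r" by (simp add: power2_eq_square)
      hence "r\<^sup>2 \<le> N" using pr assms by linarith
      thus ?thesis using r m by (intro exI[of _ r]) auto
    qed
  qed
  thus ?thesis using n unfolding BB_iff sieve_primes_def
    by (auto simp: prime_factors_dvd)
qed

section \<open>A Buchstab identity\<close>

text \<open>The Moebius function restricted to products of sieving primes.\<close>

definition sieve_mu :: "nat \<Rightarrow> nat \<Rightarrow> complex" where
  "sieve_mu N d = (if squarefree d \<and> prime_factors d \<subseteq> sieve_primes N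
     then (-1) ^ card (prime_factors d) else 0)"

definition least_prime :: "nat \<Rightarrow> nat" where
  "least_prime u = Min (prime_factors u)"

text \<open>The default \<open>N\<close> is at least every sieving prime, so a \<open>w\<close>
  without sieving primes imposes no restriction; it also keeps the values bounded, as the Fourier
  separation requires.\<close>

definition least_sieve_prime :: "nat \<Rightarrow> nat \<Rightarrow> nat" where
  "least_sieve_prime N w = Min (insert N (prime_factors w \<inter> sieve_primes N))"

text \<open>The window selects the \<open>u\<close> that have just crossed \<open>X\<close>:
  removing the least prime brings them back to at most \<open>X\<close>.\<close>

definition typeII_coeff :: "nat \<Rightarrow> real \<Rightarrow> nat \<Rightarrow> complex" where
  "typeII_coeff N X u = (if X < real u \<and> real u \<le> X * real (least_prime u) then sieve_mu N u else 0)"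

lemma norm_sieve_mu_le: "cmod (sieve_mu N d) \<le> 1"
  by (simp add: sieve_mu_def norm_power)

lemma norm_typeII_coeff_le: "cmod (typeII_coeff N X u) \<le> 1"
  by (simp add: typeII_coeff_def norm_sieve_mu_le)

lemma sieve_mu_nonzero:
  assumes "sieve_mu N d \<noteq> 0"
  shows "squarefree d" "prime_factors d \<subseteq> sieve_primes N" "d > 0" "odd d"
proof -
  show 1: "squarefree d" "prime_factors d \<subseteq> sieve_primes N"
    using assms by (auto simp: sieve_mu_def split: if_splits)
  show "d > 0" using 1(1) by (auto intro: Nat.gr0I)
  show "odd d"
  proof
    assume "even d"
    hence "2 \<in> prime_factors d" using \<open>d > 0\<close> by (auto simp: prime_factors_dvd)
    hence "2 \<in> sieve_primes N" using 1 by blast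
    thus False by (simp add: sieve_primes_def)
  qed
qed

lemma sieve_mu_1: "sieve_mu N (Suc 0) = 1"
  by (simp add: sieve_mu_def)

lemma sieve_prime_le: "p \<in> sieve_primes N \<Longrightarrow> p \<le> N"
proof -
  assume "p \<in> sieve_primes N"
  hence "p * p \<le> N" "p \<ge> 1" by (auto simp: sieve_primes_def power2_eq_square prime_ge_1_nat)
  moreover have "p * 1 \<le> p * p" using \<open>p \<ge> 1\<close> by (intro mult_le_mono) auto
  ultimately show "p \<le> N" by linarith
qed

lemma least_sieve_prime_le: "least_sieve_prime N w \<le> N"
  by (simp add: least_sieve_prime_def)

lemma prime_mult_squarefree:
  fixes s e :: nat
  assumes "prime s" "e > 0"
  shows "squarefree (s * e) \<longleftrightarrow> squarefree e \<and> \<not> s dvd e"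
proof
  assume sq: "squarefree (s * e)"
  hence "squarefree e" by (rule squarefree_multD)
  moreover have "\<not> s dvd e"
  proof
    assume "s dvd e"
    hence "s\<^sup>2 dvd s * e" by (simp add: power2_eq_square)
    hence "is_unit s" using sq by (rule squarefreeD[rotated])
    thus False using assms by simp
  qed
  ultimately show "squarefree e \<and> \<not> s dvd e" by simp
next
  assume "squarefree e \<and> \<not> s dvd e"
  thus "squarefree (s * e)" using assms
    by (intro squarefree_mult_coprime prime_imp_coprime) (auto intro: squarefree_prime)
qed

lemma prime_factors_prime_mult:
  fixes s e :: nat
  assumes "prime s" "e > 0"
  shows "prime_factors (s * e) = insert s (prime_factors e)"
  using assms by (subst prime_factors_product) (auto simp: prime_prime_factors)

lemma sieve_mu_prime_mult:
  assumes s: "s \<in> sieve_primes N" and e: "e > 0" "\<not> s dvd e"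
  shows "sieve_mu N (s * e) = - sieve_mu N e"
proof -
  have "prime s" using s by (simp add: sieve_primes_def)
  moreover have "s \<notin> prime_factors e" using e by (auto simp: prime_factors_dvd)
  ultimately show ?thesis
    using assms by (simp add: sieve_mu_def prime_mult_squarefree prime_factors_prime_mult)
qed

text \<open>If \<open>n\<close> has a least sieving prime \<open>s\<close>, the terms for \<open>d\<close> and \<open>s d\<close> with
  \<open>d\<close> prime to \<open>s\<close> cancel.\<close>

lemma buchstab_identity:
  assumes n: "n mod 4 = 1" "n \<le> N" and X: "X \<ge> 1"
  shows "b_char n = (\<Sum>d | d dvd n. of_bool (real d \<le> X) * sieve_mu N d)
    + (\<Sum>u | u dvd n. of_bool (least_prime u \<le> least_sieve_prime N (n div u)) * typeII_coeff N X u)"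
proof -
  define S where "S = prime_factors n \<inter> sieve_primes N"
  have n0: "n > 0" using n(1) by presburger
  have fin: "finite {d. d dvd n}" using n0 by simp
  have pf: "prime_factors d \<subseteq> S" if "d dvd n" "sieve_mu N d \<noteq> 0" for d
    using that sieve_mu_nonzero(2)[OF that(2)] n0 unfolding S_def by (auto dest: dvd_prime_factors[rotated])
  have b: "b_char n = of_bool (S = {})"
    unfolding b_char_def S_def using BB_iff_sieve[OF n] by simp
  show ?thesis
  proof (cases "S = {}")
    case True
    have one: "d = 1" if "d dvd n" "sieve_mu N d \<noteq> 0" for d
    proof -
      have "prime_factors d = {}" using pf[OF that] True by simp
      thus ?thesis using sieve_mu_nonzero(3)[OF that(2)]
        by (metis One_nat_def dvd_refl empty_iff prime_factor_nat prime_factors_dvd mem_Collect_eq less_not_refl dvd_imp_le)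
    qed
    have "(\<Sum>d | d dvd n. of_bool (real d \<le> X) * sieve_mu N d) = (\<Sum>d\<in>{1}. of_bool (real d \<le> X) * sieve_mu N d)"
      using fin one by (intro sum.mono_neutral_right) auto
    moreover have "(\<Sum>u | u dvd n. of_bool (least_prime u \<le> least_sieve_prime N (n div u)) * typeII_coeff N X u) = 0"
    proof (intro sum.neutral ballI)
      fix u assume u: "u \<in> {u. u dvd n}"
      have "typeII_coeff N X u = 0"
        using one[of u] u X by (cases "sieve_mu N u = 0") (auto simp: typeII_coeff_def)
      thus "of_bool (least_prime u \<le> least_sieve_prime N (n div u)) * typeII_coeff N X u = 0" by simp
    qed
    ultimately show ?thesis using b True X by (simp add: sieve_mu_1)
  next
    case False
    have finS: "finite S" by (simp add: S_def)
    define s where "s = Min S"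
    have sS: "s \<in> S" and s_le: "\<And>p. p \<in> S \<Longrightarrow> s \<le> p"
      unfolding s_def using False finS by auto
    have s: "prime s" "s dvd n" "s \<in> sieve_primes N" using sS by (auto simp: S_def prime_factors_dvd)
    \<comment> \<open>The total weight of \<open>d\<close> in both sums. For \<open>d\<close> not
      divisible by \<open>s\<close>, \<open>h (s * d)\<close> tests whether \<open>s * d\<close> is
      at most \<open>X\<close>, or lies above \<open>X\<close> but not above \<open>X * s\<close>;
      together this says \<open>d \<le> X\<close>, so \<open>h (s * d) = h d\<close>, while
      \<open>sieve_mu\<close> changes sign.\<close>
    define h where "h d = (of_bool (real d \<le> X) + of_bool (X < real d \<and> real d \<le> X * real s \<and> s dvd d) :: complex)" for d
    \<comment> \<open>All sieving primes of \<open>n\<close> are at least \<open>s\<close>, and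
      \<open>s\<close> divides \<open>u\<close> or its cofactor. Hence on the support the comparison
      of primes says exactly that \<open>s\<close> divides \<open>u\<close>, and then
      \<open>least_prime u = s\<close>.\<close>
    have cond: "of_bool (least_prime u \<le> least_sieve_prime N (n div u)) * typeII_coeff N X u
        = of_bool (X < real u \<and> real u \<le> X * real s \<and> s dvd u) * sieve_mu N u" if u: "u dvd n" for u
    proof (cases "sieve_mu N u = 0 \<or> \<not> X < real u")
      case True
      thus ?thesis by (auto simp: typeII_coeff_def)
    next
      case False
      hence u1: "sieve_mu N u \<noteq> 0" "X < real u" by auto
      have "u \<noteq> 1" using u1 X by auto
      then obtain p where "prime p" "p dvd u" using prime_factor_nat by blast
      hence ne: "prime_factors u \<noteq> {}" using sieve_mu_nonzero(3)[OF u1(1)] by (auto simp: prime_factors_dvd)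
      have lp: "least_prime u \<in> prime_factors u" "\<And>p. p \<in> prime_factors u \<Longrightarrow> least_prime u \<le> p"
        unfolding least_prime_def using ne by auto
      have sl: "s \<le> least_prime u" using lp(1) pf[OF u u1(1)] s_le by blast
      have u0: "u > 0" using sieve_mu_nonzero(3)[OF u1(1)] .
      have w0: "n div u > 0" using u n0 by (auto elim!: dvdE)
      have lw: "least_sieve_prime N (n div u) \<le> p" if "p \<in> prime_factors (n div u) \<inter> sieve_primes N" for p
        unfolding least_sieve_prime_def using that by (intro Min_le) auto
      have "least_prime u \<le> least_sieve_prime N (n div u) \<longleftrightarrow> s dvd u"
      proof
        assume le: "least_prime u \<le> least_sieve_prime N (n div u)"
        have "s dvd u * (n div u)" using u s by simp
        hence "s dvd u \<or> s dvd n div u" using s by (simp only: prime_dvd_mult_iff)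
        thus "s dvd u"
        proof
          assume "s dvd n div u"
          hence "s \<in> prime_factors (n div u) \<inter> sieve_primes N" using s w0 by (auto simp: prime_factors_dvd)
          hence "least_prime u = s" using lw le sl by fastforce
          thus ?thesis using lp(1) by (auto simp: prime_factors_dvd)
        qed
      next
        assume "s dvd u"
        hence "least_prime u \<le> s" using lp(2) s u0 by (auto simp: prime_factors_dvd)
        moreover have "s \<le> least_sieve_prime N (n div u)"
        proof -
          have "s \<le> p" if "p \<in> prime_factors (n div u) \<inter> sieve_primes N" for p
          proof (rule s_le)
            have "n div u dvd n" using u by (metis dvd_div_mult_self dvd_triv_left)
            thus "p \<in> S" using that n0 by (auto simp: S_def dest: dvd_prime_factors[rotated])
          qed
          thus ?thesis unfolding least_sieve_prime_def using sieve_prime_le[OF s(3)] by auto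
        qed
        ultimately show "least_prime u \<le> least_sieve_prime N (n div u)" by simp
      qed
      moreover have "least_prime u = s" if "s dvd u"
      proof -
        have "least_prime u \<le> s" using that lp(2) s u0 by (auto simp: prime_factors_dvd)
        thus ?thesis using sl by simp
      qed
      ultimately show ?thesis by (auto simp: typeII_coeff_def)
    qed
    define D1 where "D1 = {d. d dvd n \<and> sieve_mu N d \<noteq> 0 \<and> \<not> s dvd d}"
    define D2 where "D2 = {d. d dvd n \<and> sieve_mu N d \<noteq> 0 \<and> s dvd d}"
    have finD: "finite D1" "finite D2" using fin unfolding D1_def D2_def by (auto elim: rev_finite_subset)
    have s0: "s > 0" using s by (simp add: prime_gt_0_nat)
    have "(\<Sum>d | d dvd n. of_bool (real d \<le> X) * sieve_mu N d)
      + (\<Sum>u | u dvd n. of_bool (least_prime u \<le> least_sieve_prime N (n div u)) * typeII_coeff N X u)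
      = (\<Sum>d | d dvd n. h d * sieve_mu N d)"
      unfolding h_def distrib_right sum.distrib using cond by (intro arg_cong2[of _ _ _ _ "(+)"] sum.cong) auto
    also have "\<dots> = (\<Sum>d\<in>D1 \<union> D2. h d * sieve_mu N d)"
      by (rule sum.mono_neutral_right) (auto simp: D1_def D2_def fin)
    also have "\<dots> = (\<Sum>d\<in>D1. h d * sieve_mu N d) + (\<Sum>d\<in>D2. h d * sieve_mu N d)"
      using finD by (intro sum.union_disjoint) (auto simp: D1_def D2_def)
    also have "(\<Sum>d\<in>D2. h d * sieve_mu N d) = (\<Sum>d\<in>D1. h (s * d) * sieve_mu N (s * d))"
    proof (rule sum.reindex_bij_witness[of _ "\<lambda>d. s * d" "\<lambda>d. d div s"])
      fix d assume d: "d \<in> D2"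
      then obtain e where e: "d = s * e" by (auto simp: D2_def)
      have nz: "sieve_mu N d \<noteq> 0" using d by (simp add: D2_def)
      have e0: "e > 0" using sieve_mu_nonzero(3)[OF nz] e by auto
      have "squarefree (s * e)" using sieve_mu_nonzero(1)[OF nz] e by simp
      hence "\<not> s dvd e" using prime_mult_squarefree[OF s(1) e0] by simp
      moreover have "sieve_mu N e \<noteq> 0" using sieve_mu_prime_mult[OF s(3) e0 calculation] nz e by simp
      moreover have "e dvd n" using d e by (auto simp: D2_def elim: dvd_mult_right)
      ultimately show "d div s \<in> D1" using e s0 by (simp add: D1_def)
      show "s * (d div s) = d" using e by simp
      show "h (s * (d div s)) * sieve_mu N (s * (d div s)) = h d * sieve_mu N d" using e by simp
    next
      fix d assume d: "d \<in> D1"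
      hence nz: "sieve_mu N d \<noteq> 0" "\<not> s dvd d" "d dvd n" by (auto simp: D1_def)
      show "s * d div s = d" using s0 by simp
      have "s * d dvd n" using nz s by (intro divides_mult prime_imp_coprime) auto
      thus "s * d \<in> D2" using nz sieve_mu_prime_mult[OF s(3) sieve_mu_nonzero(3)[OF nz(1)] nz(2)] by (simp add: D2_def)
    qed
    also have "(\<Sum>d\<in>D1. h (s * d) * sieve_mu N (s * d)) = (\<Sum>d\<in>D1. - (h d * sieve_mu N d))"
    proof (intro sum.cong refl)
      fix d assume d: "d \<in> D1"
      hence nz: "sieve_mu N d \<noteq> 0" "\<not> s dvd d" "d dvd n" by (auto simp: D1_def)
      have d0: "d > 0" using sieve_mu_nonzero(3)[OF nz(1)] .
      have sr: "real s \<ge> 1" using s0 by simp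
      have "real d * 1 \<le> real d * real s" using sr by (intro mult_left_mono) auto
      hence "h (s * d) = h d"
        using nz(2) sr by (auto simp: h_def mult.commute)
      thus "h (s * d) * sieve_mu N (s * d) = - (h d * sieve_mu N d)"
        using sieve_mu_prime_mult[OF s(3) d0 nz(2)] by simp
    qed
    also have "(\<Sum>d\<in>D1. h d * sieve_mu N d) + (\<Sum>d\<in>D1. - (h d * sieve_mu N d)) = 0"
      by (simp add: sum_negf)
    finally show ?thesis using b False by simp
  qed
qed

text \<open>Write \<open>u = p * e\<close> with \<open>p\<close> its least prime; the window gives
  \<open>e \<le> X\<close>. If \<open>e\<close> is not 1, its primes are at least \<open>p\<close>,
  so \<open>p \<le> e \<le> X\<close>; if \<open>u = p\<close>, then
  \<open>p\<^sup>2 \<le> N \<le> X ^ 4\<close>.\<close>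

lemma typeII_coeff_support:
  assumes "typeII_coeff N X u \<noteq> 0" "X \<ge> 1" "real N \<le> X ^ 4"
  shows "X < real u" "real u \<le> X\<^sup>2" "least_prime u \<le> N" "odd u"
proof -
  have nz: "sieve_mu N u \<noteq> 0" and u: "X < real u" "real u \<le> X * real (least_prime u)"
    using assms by (auto simp: typeII_coeff_def split: if_splits)
  show "X < real u" by fact
  show "odd u" using sieve_mu_nonzero(4)[OF nz] .
  have u0: "u > 0" using sieve_mu_nonzero(3)[OF nz] .
  have "u \<noteq> 1" using u assms by auto
  then obtain p where "prime p" "p dvd u" using prime_factor_nat by blast
  hence ne: "prime_factors u \<noteq> {}" using u0 by (auto simp: prime_factors_dvd)
  define p where "p = least_prime u"
  have lp: "p \<in> prime_factors u" "\<And>r. r \<in> prime_factors u \<Longrightarrow> p \<le> r"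
    unfolding least_prime_def p_def using ne by auto
  have pP: "p \<in> sieve_primes N" using lp(1) sieve_mu_nonzero(2)[OF nz] by blast
  show "least_prime u \<le> N" using sieve_prime_le[OF pP] by (simp add: p_def)
  have pp: "prime p" using pP by (simp add: sieve_primes_def)
  have p0: "real p > 0" using pp by (simp add: prime_gt_0_nat)
  show "real u \<le> X\<^sup>2"
  proof (cases "u = p")
    case True
    have "p\<^sup>2 \<le> N" using pP by (simp add: sieve_primes_def)
    hence "(real p)\<^sup>2 \<le> real N" by (metis of_nat_le_iff of_nat_power)
    also have "\<dots> \<le> (X\<^sup>2)\<^sup>2" using assms(3) by simp
    finally have "real p \<le> X\<^sup>2" by (rule power2_le_imp_le) simp
    thus ?thesis using True by simp
  next
    case False
    obtain e where e: "u = p * e" using lp(1) by (auto simp: prime_factors_dvd)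
    have "e \<noteq> 1" using False e by auto
    then obtain r where r: "prime r" "r dvd e" using prime_factor_nat by blast
    have "r \<in> prime_factors u" using r e u0 by (auto simp: prime_factors_dvd)
    hence "p \<le> r" by (rule lp(2))
    also have "r \<le> e" using r e u0 by (intro dvd_imp_le) auto
    finally have "real p \<le> real e" by simp
    moreover have "real u \<le> X * real p" using u(2) by (simp add: p_def)
    hence "real p * real e \<le> real p * X" by (simp add: e mult.commute)
    hence eX: "real e \<le> X" using p0 by simp
    ultimately have "real p * real e \<le> X * X" using assms by (intro mult_mono) auto
    thus ?thesis by (simp add: e power2_eq_square)
  qed
qed

section \<open>Type I and bilinear sums\<close>

lemma sum_divisors_eq_sum_pairs:
  fixes F :: "nat \<Rightarrow> nat \<Rightarrow> 'a :: comm_monoid_add"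
  shows "(\<Sum>n=1..N. \<Sum>d | d dvd n. F d (n div d)) = (\<Sum>d=1..N. \<Sum>m=1..N div d. F d m)"
proof -
  have "(\<Sum>n=1..N. \<Sum>d | d dvd n. F d (n div d)) = (\<Sum>(n,d)\<in>(SIGMA n:{1..N}. {d. d dvd n}). F d (n div d))"
    by (rule sum.Sigma) auto
  also have "\<dots> = (\<Sum>(d,m)\<in>(SIGMA d:{1..N}. {1..N div d}). F d m)"
  proof (rule sum.reindex_bij_witness[of _ "\<lambda>(d,m). (d * m, d)" "\<lambda>(n,d). (d, n div d)"], goal_cases)
    case (2 a)
    then obtain n d where a: "a = (n, d)" "n \<in> {1..N}" "d dvd n" by auto
    then obtain m where m: "n = d * m" by blast
    have "d > 0" "m > 0" using a m by (auto intro!: Nat.gr0I)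
    moreover have "d \<le> N" using a dvd_imp_le[of d n] by auto
    moreover have "m \<le> N div d" using a m \<open>d > 0\<close> by (simp add: less_eq_div_iff_mult_less_eq mult.commute)
    ultimately have "d \<in> {1..N}" "n div d \<in> {1..N div d}" using a m by auto
    thus ?case using a by simp
  next
    case (4 b)
    then obtain d m where b: "b = (d, m)" "d \<in> {1..N}" "m \<in> {1..N div d}" by auto
    hence "d * m \<le> N" by (simp add: less_eq_div_iff_mult_less_eq mult.commute)
    thus ?case using b by auto
  qed auto
  also have "\<dots> = (\<Sum>d=1..N. \<Sum>m=1..N div d. F d m)"
    by (rule sum.Sigma[symmetric]) auto
  finally show ?thesis .
qed

lemma norm_progression_sum_le:
  assumes c: "c \<in> {1..3}"
  shows "cmod (\<Sum>m=1..M. of_bool (m mod 4 = c) * e_char (real m * x)) \<le> geom_bound (real M) (4 * x)"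
proof -
  \<comment> \<open>Counts the progression: \<open>4 * k + c \<le> M\<close> is equivalent to
    \<open>k < K\<close>. Because \<open>c\<close> is positive, \<open>k = 0\<close> gives an
    admissible \<open>m \<ge> 1\<close>, and \<open>K \<le> M\<close>.\<close>
  define K where "K = (M + 4 - c) div 4"
  have "(\<Sum>m=1..M. of_bool (m mod 4 = c) * e_char (real m * x)) = (\<Sum>m\<in>{m\<in>{1..M}. m mod 4 = c}. e_char (real m * x))"
    by (simp add: sum.If_cases of_bool_def if_distrib[of "\<lambda>z. z * _"] Int_def cong: if_cong)
  also have "\<dots> = (\<Sum>k<K. e_char (real (4 * k + c) * x))"
  proof (rule sum.reindex_bij_witness[of _ "\<lambda>k. 4 * k + c" "\<lambda>m. m div 4"], goal_cases)
    case (1 m)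
    thus ?case by (auto simp: div_mult_mod_eq)
  next
    case (2 m)
    hence "4 * (m div 4) + c = m" "m \<le> M" by auto
    hence "(m div 4 + 1) * 4 \<le> M + 4 - c" using c by auto
    hence "m div 4 + 1 \<le> K" unfolding K_def by (simp add: less_eq_div_iff_mult_less_eq)
    thus ?case by simp
  next
    case (4 k)
    thus ?case unfolding K_def using c by auto
  next
    case (5 m)
    hence "4 * (m div 4) + c = m" by auto
    thus ?case by (simp only:)
  qed (use c in auto)
  also have "\<dots> = e_char (real c * x) * (\<Sum>k<K. e_char (real k * (4 * x)))"
    unfolding sum_distrib_left e_char_add[symmetric] by (intro sum.cong arg_cong[of _ _ e_char]) (auto simp: algebra_simps)
  also have "cmod \<dots> \<le> geom_bound (real K) (4 * x)"
    using norm_geom_sum_le[where n = K and x = "4 * x"] by (simp add: norm_mult)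
  also have "\<dots> \<le> geom_bound (real M) (4 * x)"
    by (rule geom_bound_mono) (use c in \<open>auto simp: K_def\<close>)
  finally show ?thesis .
qed

lemma norm_sum_1_le: "cmod (\<Sum>l=1..L. e_char (real l * x)) \<le> geom_bound (real L) x"
proof -
  have "(\<Sum>l=1..L. e_char (real l * x)) = (\<Sum>k<L. e_char (real (Suc k) * x))"
    by (rule sum.reindex_bij_witness[of _ Suc "\<lambda>l. l - 1"]) auto
  also have "\<dots> = e_char x * (\<Sum>k<L. e_char (real k * x))"
    unfolding sum_distrib_left e_char_add[symmetric] by (intro sum.cong arg_cong[of _ _ e_char]) (auto simp: algebra_simps)
  finally show ?thesis using norm_geom_sum_le[where n = L and x = x] by (simp add: norm_mult)
qed

text \<open>After opening the square, the sum over \<open>l\<close> is geometric with frequency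
  \<open>(w - w') * \<alpha>\<close>. For fixed \<open>w\<close> each nonzero difference occurs at
  most twice up to sign, and \<open>geom_bound\<close> is even; the diagonal contributes at most
  \<open>L\<close>.\<close>

lemma mean_square_le:
  assumes B: "\<And>w. cmod (B w) \<le> 1"
  shows "(\<Sum>l=1..L. (cmod (\<Sum>w=1..W. B w * e_char (real l * (real w * \<alpha>))))\<^sup>2)
     \<le> W * (L + 2 * (\<Sum>h=1..W. geom_bound L (real h * \<alpha>)))" (is "?lhs \<le> _")
proof -
  define T where "T w = (\<Sum>w'=1..W. geom_bound L ((real w - real w') * \<alpha>))" for w :: nat
  let ?E = "\<lambda>l w. e_char (real l * (real w * \<alpha>))"
  have "complex_of_real ?lhs = (\<Sum>l=1..L. (\<Sum>w=1..W. B w * ?E l w) * (\<Sum>w=1..W. cnj (B w * ?E l w)))"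
    by (simp only: of_real_sum complex_norm_square cnj_sum)
  also have "\<dots> = (\<Sum>l=1..L. \<Sum>w=1..W. \<Sum>w'=1..W. (B w * cnj (B w')) * e_char (real l * ((real w - real w') * \<alpha>)))"
    unfolding sum_product
  proof (intro sum.cong refl)
    fix l w w' :: nat
    have "?E l w * cnj (?E l w') = e_char (real l * ((real w - real w') * \<alpha>))"
      unfolding e_char_uminus[symmetric] e_char_add[symmetric] by (intro arg_cong[of _ _ e_char]) (simp add: algebra_simps)
    thus "B w * ?E l w * cnj (B w' * ?E l w') = (B w * cnj (B w')) * e_char (real l * ((real w - real w') * \<alpha>))"
      by (simp add: mult_ac)
  qed
  also have "\<dots> = (\<Sum>w=1..W. \<Sum>w'=1..W. \<Sum>l=1..L. (B w * cnj (B w')) * e_char (real l * ((real w - real w') * \<alpha>)))"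
    by (subst sum.swap[of _ "{1..W}" "{1..L}"]) (intro sum.cong refl sum.swap)
  also have "\<dots> = (\<Sum>w=1..W. \<Sum>w'=1..W. (B w * cnj (B w')) * (\<Sum>l=1..L. e_char (real l * ((real w - real w') * \<alpha>))))"
    by (simp only: sum_distrib_left)
  finally have eq: "complex_of_real ?lhs = \<dots>" .
  have "?lhs \<le> \<bar>?lhs\<bar>" by simp
  also have "\<dots> = cmod (complex_of_real ?lhs)" by (simp only: norm_of_real real_norm_def)
  also have "\<dots> \<le> (\<Sum>w=1..W. T w)"
    unfolding eq T_def
  proof (intro sum_norm_le)
    fix w w' :: nat
    have "cmod (B w) * cmod (B w') \<le> 1 * 1" using B by (intro mult_mono) auto
    hence "cmod (B w * cnj (B w')) * cmod (\<Sum>l=1..L. e_char (real l * ((real w - real w') * \<alpha>)))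
       \<le> 1 * geom_bound L ((real w - real w') * \<alpha>)"
      by (intro mult_mono norm_sum_1_le) (auto simp: norm_mult)
    thus "cmod (B w * cnj (B w') * (\<Sum>l=1..L. e_char (real l * ((real w - real w') * \<alpha>))))
       \<le> geom_bound L ((real w - real w') * \<alpha>)" by (simp add: norm_mult)
  qed
  also have "\<dots> \<le> (\<Sum>w=1..W. L + 2 * (\<Sum>h=1..W. geom_bound L (real h * \<alpha>)))"
  proof (rule sum_mono)
    fix w assume w: "w \<in> {1..W}"
    let ?G = "\<lambda>h. geom_bound (real L) (real h * \<alpha>)"
    have nn: "?G h \<ge> 0" for h by (simp add: geom_bound_nonneg)
    have split: "{1..W} = {1..<w} \<union> insert w {w<..W}" using w by auto
    have "T w = (\<Sum>w'\<in>{1..<w}. geom_bound L ((real w - real w') * \<alpha>)) +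
       (geom_bound L 0 + (\<Sum>w'\<in>{w<..W}. geom_bound L ((real w - real w') * \<alpha>)))"
      unfolding T_def split by (subst sum.union_disjoint) auto
    also have "(\<Sum>w'\<in>{1..<w}. geom_bound L ((real w - real w') * \<alpha>)) = (\<Sum>h\<in>{1..<w}. ?G h)"
      by (rule sum.reindex_bij_witness[of _ "\<lambda>h. w - h" "\<lambda>h. w - h"]) (auto simp: of_nat_diff)
    also have "\<dots> \<le> (\<Sum>h=1..W. ?G h)"
      using w nn by (intro sum_mono2) auto
    also have "(\<Sum>w'\<in>{w<..W}. geom_bound L ((real w - real w') * \<alpha>)) = (\<Sum>h\<in>{1..W - w}. ?G h)"
    proof (rule sum.reindex_bij_witness[of _ "\<lambda>h. w + h" "\<lambda>h. h - w"])
      fix a assume a: "a \<in> {w<..W}"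
      hence "(real w - real a) * \<alpha> = - (real (a - w) * \<alpha>)" by (simp add: of_nat_diff algebra_simps)
      thus "geom_bound L (real (a - w) * \<alpha>) = geom_bound L ((real w - real a) * \<alpha>)"
        by (simp only: geom_bound_uminus)
    qed auto
    also have "\<dots> \<le> (\<Sum>h=1..W. ?G h)"
      using w nn by (intro sum_mono2) auto
    also have "geom_bound L 0 \<le> L" by (rule geom_bound_le)
    finally show "T w \<le> L + 2 * (\<Sum>h=1..W. ?G h)" by simp
  qed
  finally show ?thesis by (simp add: sum_distrib_left)
qed

context rational_approx
begin

text \<open>The factor 4 stems from summation over a residue class modulo 4. For
  \<open>l = r * d\<close> the cap \<open>N / d\<close> is at most \<open>R * N / l\<close>.
  Cauchy's inequality with \<open>\<phi>\<close> split into two square roots sets the trivial cap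
  against the weighted divisor moment in one factor and leaves Vinogradov's bound for the
  other.\<close>

lemma typeI_sum_le:
  assumes H: "harm (2 * q) \<le> H" "harm (4 * (R * Y)) \<le> H"
  shows "(\<Sum>r=1..R. \<Sum>d=1..Y. geom_bound (real N / real d) (4 * (real r * real d * \<alpha>)))
     \<le> 4 * H ^ 3 * sqrt (real R * N * (real R * N / q + real R * Y + q))"
proof -
  define \<phi> where "\<phi> l = geom_bound (real R * real N / real l) (4 * (real l * \<alpha>))" for l
  define \<tau> where "\<tau> l = real (card {d. d dvd l})" for l :: nat
  define V where "V = real R * N / q + real R * Y + q"
  have \<phi>0: "\<phi> l \<ge> 0" for l by (simp add: \<phi>_def geom_bound_nonneg)
  have h1: "harm (R * Y) \<le> H" using H(2) harm_mono[of "R * Y" "4 * (R * Y)", where ?'a = real] by simp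
  have "(1::real) = harm 1" by (simp add: harm_def)
  also have "\<dots> \<le> harm (2 * q)" using q_ge_1 by (intro harm_mono) auto
  finally have H1: "H \<ge> 1" using H(1) by linarith
  have hn: "0 \<le> (harm (R * Y) :: real)" by (rule harm_nonneg)
  have V0: "V \<ge> 0" by (simp add: V_def)
  have "(\<Sum>r=1..R. \<Sum>d=1..Y. geom_bound (real N / real d) (4 * (real r * real d * \<alpha>)))
      \<le> (\<Sum>r=1..R. \<Sum>d=1..Y. \<phi> (r * d))"
  proof (intro sum_mono)
    fix r d assume r: "r \<in> {1..R}" "d \<in> {1..Y}"
    have "real N / real d = real r * real N / real (r * d)" using r by simp
    also have "\<dots> \<le> real R * real N / real (r * d)"
      using r by (intro divide_right_mono mult_right_mono) auto
    finally show "geom_bound (real N / real d) (4 * (real r * real d * \<alpha>)) \<le> \<phi> (r * d)"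
      unfolding \<phi>_def by (simp add: geom_bound_mono)
  qed
  also have "\<dots> \<le> (\<Sum>l=1..R*Y. \<tau> l * \<phi> l)"
    unfolding \<tau>_def by (rule sum_pairs_le_sum_divisors) (rule \<phi>0)
  also have "\<dots> = (\<Sum>l=1..R*Y. (\<tau> l * sqrt (\<phi> l)) * sqrt (\<phi> l))"
    using \<phi>0 by (simp add: mult.assoc)
  also have "\<dots> \<le> sqrt (\<Sum>l=1..R*Y. (\<tau> l * sqrt (\<phi> l))\<^sup>2) * sqrt (\<Sum>l=1..R*Y. (sqrt (\<phi> l))\<^sup>2)"
    by (rule sum_mult_le_sqrt)
  also have "\<dots> = sqrt (\<Sum>l=1..R*Y. (\<tau> l)\<^sup>2 * \<phi> l) * sqrt (\<Sum>l=1..R*Y. \<phi> l)"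
    using \<phi>0 by (simp add: power_mult_distrib)
  also have "\<dots> \<le> sqrt (real R * N * H ^ 4) * sqrt (16 * H * V)"
  proof (intro mult_mono real_sqrt_le_mono)
    have "(\<Sum>l=1..R*Y. (\<tau> l)\<^sup>2 * \<phi> l) \<le> (\<Sum>l=1..R*Y. (\<tau> l)\<^sup>2 * (real R * real N / real l))"
      unfolding \<phi>_def by (intro sum_mono mult_left_mono geom_bound_le) auto
    also have "\<dots> = real R * N * (\<Sum>l=1..R*Y. (\<tau> l)\<^sup>2 / real l)"
      by (simp add: sum_distrib_left mult_ac)
    also have "\<dots> \<le> real R * N * harm (R * Y) ^ 4"
      unfolding \<tau>_def by (intro mult_left_mono sum_divisor_count_sq_le) auto
    also have "\<dots> \<le> real R * N * H ^ 4"
      using h1 hn by (intro mult_left_mono power_mono) auto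
    finally show "(\<Sum>l=1..R*Y. (\<tau> l)\<^sup>2 * \<phi> l) \<le> real R * N * H ^ 4" .
    \<comment> \<open>The multiples \<open>4 * l\<close> become the summation index, with the cap
      rescaled by 4, so the approximation to \<alpha> itself can be used.\<close>
    have "(\<Sum>l=1..R*Y. \<phi> l) = (\<Sum>l\<in>(\<lambda>l. 4 * l) ` {1..R*Y}. geom_bound (4 * real R * real N / real l) (real l * \<alpha>))"
      by (subst sum.reindex) (auto simp: inj_on_def \<phi>_def mult_ac)
    also have "\<dots> \<le> (\<Sum>l=1..4*(R*Y). geom_bound (4 * real R * real N / real l) (real l * \<alpha>))"
      by (intro sum_mono2) (auto intro: geom_bound_nonneg)
    also have "\<dots> \<le> 4 * H * (4 * real R * real N / q + real (4 * (R * Y)) + q)"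
      by (rule vinogradov_sum) (use H in auto)
    also have "\<dots> \<le> 4 * H * (4 * V)"
      using H1 by (intro mult_left_mono) (auto simp: V_def field_simps)
    finally show "(\<Sum>l=1..R*Y. \<phi> l) \<le> 16 * H * V" by simp
  qed (auto intro!: sum_nonneg mult_nonneg_nonneg \<phi>0)
  also have "\<dots> = sqrt (16 * (real R * N * V) * H ^ 5)"
    by (simp add: real_sqrt_mult[symmetric] mult_ac power_numeral_reduce)
  also have "\<dots> \<le> sqrt ((4 * H ^ 3)\<^sup>2 * (real R * N * V))"
  proof (rule real_sqrt_le_mono)
    have "H ^ 5 \<le> H ^ 6" using H1 by (intro power_increasing) auto
    hence "16 * (real R * N * V) * H ^ 5 \<le> 16 * (real R * N * V) * H ^ 6"
      using V0 by (intro mult_left_mono) auto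
    thus "16 * (real R * N * V) * H ^ 5 \<le> (4 * H ^ 3)\<^sup>2 * (real R * N * V)"
      by (simp add: power_mult_distrib mult_ac flip: power_mult)
  qed
  also have "\<dots> = 4 * H ^ 3 * sqrt (real R * N * V)"
    unfolding real_sqrt_mult[of "(4 * H ^ 3)\<^sup>2"] real_sqrt_abs using H1 by simp
  finally show ?thesis by (simp add: V_def)
qed

text \<open>The bounded coefficient \<open>A\<close> is discarded by the triangle inequality, after
  which only \<open>l = r * u\<close> matters. Cauchy's inequality splits its multiplicity from the
  sum over \<open>w\<close>, and \<open>mean_square_le\<close> removes the arbitrary
  \<open>B\<close> because \<open>l\<close> runs over a full interval.\<close>

lemma bilinear_sum_le:
  assumes A: "\<And>u. cmod (A u) \<le> 1" and B: "\<And>w. cmod (B w) \<le> 1"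
    and H: "harm (2 * q) \<le> H" "harm (R * (2 * U)) \<le> H" "harm W \<le> H"
    and UW: "U * W \<le> N" "U \<ge> 1"
  shows "(\<Sum>r=1..R. cmod (\<Sum>u\<in>{U..<2*U}. \<Sum>w=1..W. A u * B w * e_char (real r * (real u * (real w * \<alpha>)))))
     \<le> 6 * H ^ 3 * sqrt (real R * N * (real R * U + real R * N / q + real N / U + q))"
proof -
  define s where "s l = cmod (\<Sum>w=1..W. B w * e_char (real l * (real w * \<alpha>)))" for l :: nat
  define \<tau> where "\<tau> l = real (card {d. d dvd l})" for l :: nat
  define L where "L = R * (2 * U)"
  define V where "V = real R * U + real R * N / q + real N / U + q"
  have V0: "V \<ge> 0" by (simp add: V_def)
  have "(1::real) = harm 1" by (simp add: harm_def)
  also have "\<dots> \<le> harm (2 * q)" using q_ge_1 by (intro harm_mono) auto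
  finally have H1: "H \<ge> 1" using H(1) by linarith
  have UWr: "real U * real W \<le> real N" using UW(1) by (metis of_nat_le_iff of_nat_mult)
  have W: "real W \<le> real N / real U" using UWr UW(2) by (simp add: field_simps)
  have "(\<Sum>r=1..R. cmod (\<Sum>u\<in>{U..<2*U}. \<Sum>w=1..W. A u * B w * e_char (real r * (real u * (real w * \<alpha>)))))
     \<le> (\<Sum>r=1..R. \<Sum>u\<in>{U..<2*U}. s (r * u))"
  proof (intro sum_mono sum_norm_le)
    fix r u :: nat
    have "(\<Sum>w=1..W. A u * B w * e_char (real r * (real u * (real w * \<alpha>))))
        = A u * (\<Sum>w=1..W. B w * e_char (real (r * u) * (real w * \<alpha>)))"
      by (simp add: sum_distrib_left mult_ac)
    also have "cmod \<dots> \<le> 1 * s (r * u)"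
      unfolding norm_mult s_def using A by (intro mult_right_mono) auto
    finally show "cmod (\<Sum>w=1..W. A u * B w * e_char (real r * (real u * (real w * \<alpha>)))) \<le> s (r * u)" by simp
  qed
  also have "\<dots> \<le> (\<Sum>r=1..R. \<Sum>u=1..2*U. s (r * u))"
    using UW(2) by (intro sum_mono sum_mono2) (auto simp: s_def)
  also have "\<dots> \<le> (\<Sum>l=1..L. \<tau> l * s l)"
    unfolding \<tau>_def L_def by (rule sum_pairs_le_sum_divisors) (simp add: s_def)
  also have "\<dots> \<le> sqrt (\<Sum>l=1..L. (\<tau> l)\<^sup>2) * sqrt (\<Sum>l=1..L. (s l)\<^sup>2)"
    by (rule sum_mult_le_sqrt)
  also have "\<dots> \<le> sqrt (real L * H ^ 4) * sqrt (W * (16 * H * V))"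
  proof (intro mult_mono real_sqrt_le_mono)
    have "(\<Sum>l=1..L. (\<tau> l)\<^sup>2) \<le> (\<Sum>l=1..L. real L * ((\<tau> l)\<^sup>2 / real l))"
    proof (rule sum_mono)
      fix l assume l: "l \<in> {1..L}"
      have "(\<tau> l)\<^sup>2 * real l \<le> (\<tau> l)\<^sup>2 * real L" using l by (intro mult_left_mono) auto
      thus "(\<tau> l)\<^sup>2 \<le> real L * ((\<tau> l)\<^sup>2 / real l)" using l by (simp add: field_simps)
    qed
    also have "\<dots> = real L * (\<Sum>l=1..L. (\<tau> l)\<^sup>2 / real l)" by (simp only: sum_distrib_left)
    also have "\<dots> \<le> real L * harm L ^ 4"
      unfolding \<tau>_def by (intro mult_left_mono sum_divisor_count_sq_le) auto
    also have "\<dots> \<le> real L * H ^ 4"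
      using H(2) by (intro mult_left_mono power_mono) (auto simp: L_def harm_nonneg)
    finally show "(\<Sum>l=1..L. (\<tau> l)\<^sup>2) \<le> real L * H ^ 4" .
    have "(\<Sum>l=1..L. (s l)\<^sup>2) \<le> W * (L + 2 * (\<Sum>h=1..W. geom_bound L (real h * \<alpha>)))"
      unfolding s_def by (rule mean_square_le) (rule B)
    \<comment> \<open>Enlarging the cap \<open>L\<close> to \<open>L * W / h\<close>, legitimate as
      \<open>h \<le> W\<close>, gives the shape treated by \<open>vinogradov_sum\<close>.\<close>
    also have "(\<Sum>h=1..W. geom_bound L (real h * \<alpha>)) \<le> (\<Sum>h=1..W. geom_bound (real L * W / real h) (real h * \<alpha>))"
    proof (intro sum_mono geom_bound_mono)
      fix h assume h: "h \<in> {1..W}"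
      have "real L * real h \<le> real L * W" using h by (intro mult_left_mono) auto
      thus "real L \<le> real L * W / real h" using h by (simp add: field_simps)
    qed
    also have "\<dots> \<le> 4 * H * (real L * W / q + W + q)"
      by (rule vinogradov_sum) (use H in auto)
    also have "L + 2 * (4 * H * (real L * W / q + W + q)) \<le> 16 * H * V"
    proof -
      have "real L * W = 2 * R * (real U * W)" by (simp add: L_def)
      also have "\<dots> \<le> 2 * R * real N" using UWr by (intro mult_left_mono) auto
      finally have "real L * W / q \<le> 2 * R * real N / q" by (rule divide_right_mono) simp
      hence "real L * W / q + W + q \<le> 2 * (real R * N / q) + real N / U + q" using W by simp
      hence "4 * H * (real L * W / q + W + q) \<le> 4 * H * (2 * (real R * N / q) + real N / U + q)"
        using H1 by (intro mult_left_mono) auto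
      moreover have "2 * (real R * U) * 1 \<le> 2 * (real R * U) * H" using H1 by (intro mult_left_mono) auto
      moreover have "0 \<le> H * (real R * U)" "0 \<le> H * (real N / U)" "0 \<le> H * q" using H1 by auto
      moreover have "16 * H * V = 16 * (H * (real R * U)) + 16 * (H * (real R * N / q)) + 16 * (H * (real N / U)) + 16 * (H * q)"
        unfolding V_def by (simp only: distrib_left mult.assoc)
      moreover have "4 * H * (2 * (real R * N / q) + real N / U + q) = 8 * (H * (real R * N / q)) + 4 * (H * (real N / U)) + 4 * (H * q)"
        by (simp only: distrib_left mult.assoc mult.left_commute)
      moreover have "real L = 2 * (real R * U)" by (simp add: L_def)
      ultimately show ?thesis by (simp add: mult.commute[of _ H])
    qed
    finally show "(\<Sum>l=1..L. (s l)\<^sup>2) \<le> W * (16 * H * V)" by (simp add: mult_left_mono)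
  qed (auto intro!: sum_nonneg)
  also have "\<dots> = sqrt (32 * (real R * (real U * W) * V) * H ^ 5)"
    by (simp add: L_def real_sqrt_mult[symmetric] mult_ac power_numeral_reduce)
  \<comment> \<open>Rounding 32 to 36 and \<open>H ^ 5\<close> to \<open>H ^ 6\<close> makes the
    factor a perfect square.\<close>
  also have "\<dots> \<le> sqrt ((6 * H ^ 3)\<^sup>2 * (real R * N * V))"
  proof (rule real_sqrt_le_mono)
    have "H ^ 5 \<le> H ^ 6" using H1 by (intro power_increasing) auto
    moreover have "real R * (real U * W) * V \<le> real R * real N * V"
      using UWr V0 by (intro mult_right_mono mult_left_mono) auto
    moreover have "0 \<le> real R * real N * V" using V0 by simp
    ultimately have "32 * (real R * (real U * W) * V) \<le> 36 * (real R * N * V)" "H ^ 5 \<le> H ^ 6"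
      by linarith+
    hence "32 * (real R * (real U * W) * V) * H ^ 5 \<le> 36 * (real R * N * V) * H ^ 6"
      by (rule mult_mono) (use V0 H1 in auto)
    thus "32 * (real R * (real U * W) * V) * H ^ 5 \<le> (6 * H ^ 3)\<^sup>2 * (real R * N * V)"
      by (simp add: power_mult_distrib mult_ac flip: power_mult)
  qed
  also have "\<dots> = 6 * H ^ 3 * sqrt (real R * N * V)"
    unfolding real_sqrt_mult[of "(6 * H ^ 3)\<^sup>2"] real_sqrt_abs using H1 by simp
  finally show ?thesis by (simp add: V_def)
qed

end

section \<open>Decomposition of the exponential sum\<close>

lemma sum_dyadic:
  fixes G :: "nat \<Rightarrow> 'a :: comm_monoid_add"
  shows "(\<Sum>u\<in>{1..<2^n}. G u) = (\<Sum>i<n. \<Sum>u\<in>{2^i..<2*2^i}. G u)"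
proof (induction n)
  case (Suc n)
  have "(\<Sum>u\<in>{1..<2^Suc n}. G u) = (\<Sum>u\<in>{1..<2^n}. G u) + (\<Sum>u\<in>{2^n..<2^Suc n}. G u)"
    by (rule sum.atLeastLessThan_concat[symmetric]) auto
  thus ?case using Suc by simp
qed auto

text \<open>Each unit modulo 4 is its own inverse, so \<open>u\<close> and \<open>w\<close> must
  have equal residues. As a sum of two products the condition can be absorbed into the coefficients
  of \<open>u\<close> and \<open>w\<close>.\<close>

lemma mult_mod_4_eq_1_iff:
  fixes u w :: nat
  assumes "odd u"
  shows "of_bool ((u * w) mod 4 = 1) =
    (\<Sum>c\<in>{1,3}. of_bool (u mod 4 = c) * of_bool (w mod 4 = c) :: complex)"
proof -
  have "u mod 4 \<in> {1,3}" using assms by (simp; presburger)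
  moreover have "w mod 4 \<in> {0,1,2,3}" by auto
  moreover have "(u * w) mod 4 = ((u mod 4) * (w mod 4)) mod 4" by (simp add: mod_mult_eq)
  ultimately show ?thesis by auto
qed

lemma BB_mod_4:
  assumes "n \<in> BB"
  shows "n mod 4 = 1"
proof -
  have "n mod 4 \<noteq> 3" using exists_prime_3_mod_4[of n] assms unfolding BB_iff by blast
  moreover have "odd n" using assms unfolding BB_iff by blast
  ultimately show ?thesis by presburger
qed

text \<open>\<open>BB\<close> lies in the class 1 modulo 4. Imposing that congruence on the products
  supplies the hypothesis of \<open>buchstab_identity\<close> and makes both sides vanish for the
  other \<open>n\<close>.\<close>

lemma S_sum_eq:
  fixes N :: nat
  assumes X: "X \<ge> 1"
  shows "(\<Sum>n=1..N. b_char n * e_char (real n * x)) =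
     (\<Sum>d=1..N. of_bool (real d \<le> X) * sieve_mu N d *
        (\<Sum>m=1..N div d. of_bool ((d * m) mod 4 = 1) * e_char (real m * (real d * x))))
   + (\<Sum>u=1..N. typeII_coeff N X u *
        (\<Sum>w=1..N div u. of_bool ((u * w) mod 4 = 1) *
           (of_bool (least_prime u \<le> least_sieve_prime N w) * e_char (real u * (real w * x)))))"
proof -
  define F1 where "F1 d m = of_bool (real d \<le> X) * sieve_mu N d *
        (of_bool ((d * m) mod 4 = 1) * e_char (real m * (real d * x)))" for d m :: nat
  define F2 where "F2 u w = typeII_coeff N X u *
        (of_bool ((u * w) mod 4 = 1) *
           (of_bool (least_prime u \<le> least_sieve_prime N w) * e_char (real u * (real w * x))))" for u w :: nat
  have "b_char n * e_char (real n * x) =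
     (\<Sum>d | d dvd n. F1 d (n div d)) + (\<Sum>d | d dvd n. F2 d (n div d))" if n: "n \<in> {1..N}" for n
  proof (cases "n mod 4 = 1")
    case False
    hence "b_char n = 0" using BB_mod_4[of n] by (auto simp: b_char_def)
    moreover have "F1 d (n div d) = 0" "F2 d (n div d) = 0" if "d dvd n" for d
      using that False by (auto simp: F1_def F2_def)
    ultimately show ?thesis by simp
  next
    case True
    have r: "real n * x = real (n div d) * (real d * x)" "real n * x = real d * (real (n div d) * x)" if "d dvd n" for d
      using that by (auto simp flip: of_nat_mult mult.assoc)
    have "b_char n * e_char (real n * x) =
      (\<Sum>d | d dvd n. of_bool (real d \<le> X) * sieve_mu N d * e_char (real n * x))
    + (\<Sum>u | u dvd n. of_bool (least_prime u \<le> least_sieve_prime N (n div u)) * typeII_coeff N X u * e_char (real n * x))"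
      using buchstab_identity[OF True _ X, of N] n
      by (simp only: distrib_right sum_distrib_right atLeastAtMost_iff)
    also have "(\<Sum>d | d dvd n. of_bool (real d \<le> X) * sieve_mu N d * e_char (real n * x)) = (\<Sum>d | d dvd n. F1 d (n div d))"
      using True by (intro sum.cong refl) (simp add: F1_def r(1)[symmetric])
    also have "(\<Sum>u | u dvd n. of_bool (least_prime u \<le> least_sieve_prime N (n div u)) * typeII_coeff N X u * e_char (real n * x))
       = (\<Sum>d | d dvd n. F2 d (n div d))"
      using True by (intro sum.cong refl) (simp add: F2_def r(2)[symmetric])
    finally show ?thesis .
  qed
  hence "(\<Sum>n=1..N. b_char n * e_char (real n * x)) =
     (\<Sum>n=1..N. \<Sum>d | d dvd n. F1 d (n div d)) + (\<Sum>n=1..N. \<Sum>d | d dvd n. F2 d (n div d))"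
    by (simp add: sum.distrib)
  hence "(\<Sum>n=1..N. b_char n * e_char (real n * x)) =
     (\<Sum>d=1..N. \<Sum>m=1..N div d. F1 d m) + (\<Sum>d=1..N. \<Sum>m=1..N div d. F2 d m)"
    unfolding sum_divisors_eq_sum_pairs .
  thus ?thesis
    unfolding F1_def F2_def sum_distrib_left .
qed

context rational_approx
begin

text \<open>\<open>sieve_mu\<close> lives on odd \<open>d\<close>, for which the congruence reads
  \<open>m mod 4 = d mod 4\<close>; the inner sum is then a geometric series of frequency
  \<open>4 * (d * (r * \<alpha>))\<close>.\<close>

lemma typeI_le:
  assumes H: "harm (2 * q) \<le> H" "harm (4 * (R * N)) \<le> H" and X: "1 \<le> X" "X \<le> real N"
  shows "(\<Sum>r=1..R. cmod (\<Sum>d=1..N. of_bool (real d \<le> X) * sieve_mu N d *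
        (\<Sum>m=1..N div d. of_bool ((d * m) mod 4 = 1) * e_char (real m * (real d * (real r * \<alpha>))))))
     \<le> 4 * H ^ 3 * sqrt (real R * N * (real R * X + real R * N / q + q))" (is "?lhs \<le> _")
proof -
  define Y where "Y = nat \<lfloor>X\<rfloor>"
  have Y: "Y \<ge> 1" "real Y \<le> X" "Y \<le> N" using X unfolding Y_def by linarith+
  have dY: "real d \<le> X \<longleftrightarrow> d \<le> Y" for d unfolding Y_def using X by linarith
  have "(1::real) = harm 1" by (simp add: harm_def)
  also have "\<dots> \<le> harm (2 * q)" using q_ge_1 by (intro harm_mono) auto
  finally have H1: "H \<ge> 1" using H(1) by linarith
  have summand: "cmod (of_bool (real d \<le> X) * sieve_mu N d *
        (\<Sum>m=1..N div d. of_bool ((d * m) mod 4 = 1) * e_char (real m * (real d * (real r * \<alpha>)))))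
      \<le> (if d \<le> Y then geom_bound (real N / real d) (4 * (real r * real d * \<alpha>)) else 0)"
    if d: "d \<in> {1..N}" for d r :: nat
  proof (cases "d \<le> Y \<and> sieve_mu N d \<noteq> 0")
    case False
    thus ?thesis using dY by (auto simp: geom_bound_nonneg)
  next
    case True
    have od: "odd d" using True sieve_mu_nonzero by blast
    hence d4: "d mod 4 \<in> {1,3}" by (simp; presburger)
    have "(d * m) mod 4 = 1 \<longleftrightarrow> m mod 4 = d mod 4" for m
    proof -
      have "m mod 4 \<in> {0,1,2,3}" by auto
      moreover have "(d * m) mod 4 = ((d mod 4) * (m mod 4)) mod 4" by (simp add: mod_mult_eq)
      ultimately show ?thesis using d4 by auto
    qed
    hence "cmod (\<Sum>m=1..N div d. of_bool ((d * m) mod 4 = 1) * e_char (real m * (real d * (real r * \<alpha>))))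
      = cmod (\<Sum>m=1..N div d. of_bool (m mod 4 = d mod 4) * e_char (real m * (real d * (real r * \<alpha>))))"
      by simp
    also have "\<dots> \<le> geom_bound (real (N div d)) (4 * (real d * (real r * \<alpha>)))"
      by (rule norm_progression_sum_le) (use d4 in auto)
    also have "\<dots> \<le> geom_bound (real N / real d) (4 * (real d * (real r * \<alpha>)))"
    proof (rule geom_bound_mono)
      have "real (N div d) * real d \<le> real N"
        by (metis div_times_less_eq_dividend of_nat_le_iff of_nat_mult)
      thus "real (N div d) \<le> real N / real d" using d by (simp add: field_simps)
    qed
    finally have le: "cmod (\<Sum>m=1..N div d. of_bool ((d * m) mod 4 = 1) * e_char (real m * (real d * (real r * \<alpha>))))
      \<le> geom_bound (real N / real d) (4 * (real r * real d * \<alpha>))" by (simp add: mult_ac)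
    have "cmod (of_bool (real d \<le> X) * sieve_mu N d) \<le> 1"
      using norm_sieve_mu_le[of N d] by simp
    from mult_mono[OF this le] show ?thesis using True by (simp only: norm_mult) simp
  qed
  have "?lhs \<le> (\<Sum>r=1..R. \<Sum>d=1..N. if d \<le> Y then geom_bound (real N / real d) (4 * (real r * real d * \<alpha>)) else 0)"
    by (intro sum_mono sum_norm_le summand)
  also have "\<dots> = (\<Sum>r=1..R. \<Sum>d=1..Y. geom_bound (real N / real d) (4 * (real r * real d * \<alpha>)))"
    using Y(3) by (intro sum.cong refl sum.mono_neutral_cong_right) auto
  also have "\<dots> \<le> 4 * H ^ 3 * sqrt (real R * N * (real R * N / q + real R * Y + q))"
  proof (rule typeI_sum_le)
    have "harm (4 * (R * Y)) \<le> (harm (4 * (R * N)) :: real)" using Y(3) by (intro harm_mono) auto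
    thus "harm (4 * (R * Y)) \<le> H" using H(2) by linarith
  qed (use H in auto)
  also have "\<dots> \<le> 4 * H ^ 3 * sqrt (real R * N * (real R * X + real R * N / q + q))"
  proof -
    have "real R * Y \<le> real R * X" using Y by (intro mult_left_mono) auto
    thus ?thesis using H1 by (intro mult_left_mono real_sqrt_le_mono) auto
  qed
  finally show ?thesis .
qed

text \<open>Two conditions couple \<open>u\<close> and \<open>w\<close>: the product bound and the
  comparison of primes. Each compares a function of \<open>u\<close> with a function of
  \<open>w\<close>, and removing it costs \<open>2 * H\<close>. With \<open>6 * H ^ 3\<close> from
  \<open>bilinear_sum_le\<close>, two residue classes and at most \<open>H\<close> dyadic blocks
  this makes \<open>48 * H ^ 6\<close>.\<close>

lemma typeII_le:
  assumes H: "\<And>n. n \<le> 8 * N\<^sup>2 \<Longrightarrow> harm n \<le> H" "\<And>k. 2 ^ k \<le> N \<Longrightarrow> real (Suc k) \<le> H"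
    and q: "q \<le> 4 * N\<^sup>2" and R: "R \<le> N" and N: "N \<ge> 1"
    and X: "1 \<le> X" "real N \<le> X ^ 4"
  shows "(\<Sum>r=1..R. cmod (\<Sum>u=1..N. typeII_coeff N X u *
        (\<Sum>w=1..N div u. of_bool ((u * w) mod 4 = 1) *
           (of_bool (least_prime u \<le> least_sieve_prime N w) * e_char (real u * (real w * (real r * \<alpha>)))))))
     \<le> 48 * H ^ 6 * sqrt (real R * N * (real R * X\<^sup>2 + real R * N / q + 2 * real N / X + q))" (is "?lhs \<le> _")
proof -
  define V where "V = real R * X\<^sup>2 + real R * N / q + 2 * real N / X + q"
  define E where "E = 6 * H ^ 3 * sqrt (real R * N * V)"
  define A where "A c u = typeII_coeff N X u * of_bool (u mod 4 = c)" for c u :: nat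
  define B where "B c w = (of_bool (w mod 4 = c) :: complex)" for c w :: nat
  define K where "K r u w = e_char (real r * (real u * (real w * \<alpha>)))" for r u w :: nat
  define K1 where "K1 r u w = of_bool (u \<le> N div w) * K r u w" for r u w
  \<comment> \<open>The Fourier expansion needs bounded values for every \<open>u\<close> of a
    block, hence the cap \<open>N\<close>; by \<open>typeII_coeff_support\<close> it changes nothing
    where the coefficient is nonzero.\<close>
  define K2 where "K2 r u w = of_bool (min N (least_prime u) \<le> least_sieve_prime N w) * K1 r u w" for r u w
  have V0: "V \<ge> 0" using X by (simp add: V_def)
  obtain n where n: "2 ^ n \<le> N" "N < 2 ^ (n + 1)" using ex_power_ivl1[of 2 N] N by auto
  have H1: "H \<ge> 1" using H(2)[of 0] N by simp
  have E0: "E \<ge> 0" using V0 H1 by (simp add: E_def)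
  have NN: "N \<le> N\<^sup>2" using N by (simp add: power2_eq_square)
  have A1: "cmod (A c u) \<le> 1" for c u
    using norm_typeII_coeff_le[of N X u] by (simp add: A_def)
  have B1: "cmod (B c w) \<le> 1" for c w by (simp add: B_def)
  have dyad: "(\<Sum>r=1..R. cmod (\<Sum>u\<in>{2^i..<2*2^i}. \<Sum>w=1..N div 2^i. A c u * B c w * K2 r u w)) \<le> (2 * H)\<^sup>2 * E"
    if i: "i < n + 1" for i c
  \<comment> \<open>A block without support contributes nothing. Otherwise a single supported
    \<open>u\<close> gives \<open>X \<le> 2 * U\<close> and \<open>U \<le> X\<^sup>2\<close>, which
    controls both terms of the bilinear bound that depend on \<open>U\<close>.\<close>
  proof (cases "\<exists>u\<in>{2^i..<2*2^i}. A c u \<noteq> 0")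
    case False
    hence "(\<Sum>r=1..R. cmod (\<Sum>u\<in>{2^i..<2*2^i}. \<Sum>w=1..N div 2^i. A c u * B c w * K2 r u w)) = 0"
      by (intro sum.neutral ballI) auto
    thus ?thesis using E0 H1 by simp
  next
    case True
    define U :: nat where "U = 2 ^ i"
    have U1: "U \<ge> 1" by (simp add: U_def)
    have UN: "U \<le> N"
    proof -
      have "U \<le> 2 ^ n" unfolding U_def using i by (intro power_increasing) auto
      thus ?thesis using n by simp
    qed
    from True obtain u where u: "u \<in> {U..<2*U}" "typeII_coeff N X u \<noteq> 0" by (auto simp: A_def U_def)
    note sup = typeII_coeff_support[OF u(2) X]
    have UX: "real U \<le> X\<^sup>2" using sup(2) u(1) by (meson atLeastLessThan_iff of_nat_le_iff order_trans)
    have "real u < 2 * real U" using u(1) by auto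
    hence XU: "X \<le> 2 * real U" using sup(1) by linarith
    have "R * (2 * U) \<le> N * (2 * N)" using R UN by (intro mult_le_mono) auto
    hence RU: "R * (2 * U) \<le> 8 * N\<^sup>2" by (simp add: power2_eq_square)
    define Q where "Q = 2 * N + 1"
    have "2 * Q \<le> 8 * N" using N by (simp add: Q_def)
    also have "\<dots> \<le> 8 * N\<^sup>2" using NN by simp
    finally have hQ: "harm (2 * Q) \<le> H" by (rule H(1))
    have base: "(\<Sum>r=1..R. cmod (\<Sum>u\<in>{U..<2*U}. \<Sum>w=1..N div U. A' u * B' w * K r u w)) \<le> E"
      if "\<And>u. cmod (A' u) \<le> 1" "\<And>w. cmod (B' w) \<le> 1" for A' B'
    proof -
      have "(\<Sum>r=1..R. cmod (\<Sum>u\<in>{U..<2*U}. \<Sum>w=1..N div U. A' u * B' w * K r u w))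
        \<le> 6 * H ^ 3 * sqrt (real R * N * (real R * U + real R * N / q + real N / U + q))"
        unfolding K_def
      proof (rule bilinear_sum_le[OF that])
        show "harm (2 * q) \<le> H" using q by (intro H(1)) auto
        show "harm (R * (2 * U)) \<le> H" using RU by (rule H(1))
        have "N div U \<le> N" by simp
        also have "\<dots> \<le> 8 * N\<^sup>2" using NN by simp
        finally show "harm (N div U) \<le> H" by (rule H(1))
      qed (use U1 in auto)
      also have "\<dots> \<le> E"
      proof -
        have "real R * U \<le> real R * X\<^sup>2" using UX by (intro mult_left_mono) auto
        moreover have "real N / U \<le> 2 * real N / X"
        proof -
          have "real N * X \<le> real N * (2 * real U)" using XU by (intro mult_left_mono) auto
          thus ?thesis using X U1 by (simp add: field_simps)
        qed
        ultimately show ?thesis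
          unfolding E_def V_def using H1 by (intro mult_left_mono real_sqrt_le_mono) auto
      qed
      finally show ?thesis .
    qed
    have step1: "(\<Sum>r=1..R. cmod (\<Sum>u\<in>{U..<2*U}. \<Sum>w=1..N div U. A' u * B' w * K1 r u w)) \<le> (2 * H) * E"
      if AB: "\<And>u. cmod (A' u) \<le> 1" "\<And>w. cmod (B' w) \<le> 1" for A' B'
    proof -
      have "(\<Sum>r=1..R. cmod (\<Sum>u\<in>{U..<2*U}. \<Sum>w=1..N div U. A' u * B' w * K1 r u w)) \<le> (1 + harm (2 * Q)) * E"
        unfolding K1_def
      proof (rule separation_of_variables[OF _ _ _ base AB])
        show "u < Q" if "u \<in> {U..<2*U}" for u using that UN by (auto simp: Q_def)
        show "N div w < Q" for w using div_le_dividend[of N w] unfolding Q_def by linarith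
      qed (auto simp: Q_def)
      also have "\<dots> \<le> (2 * H) * E" using hQ H1 E0 by (intro mult_right_mono) auto
      finally show ?thesis .
    qed
    have "(\<Sum>r=1..R. cmod (\<Sum>u\<in>{U..<2*U}. \<Sum>w=1..N div U. A c u * B c w * K2 r u w)) \<le> (1 + harm (2 * Q)) * ((2 * H) * E)"
      unfolding K2_def
    proof (rule separation_of_variables[OF _ _ _ step1 A1 B1])
      show "min N (least_prime u) < Q" for u by (auto simp: Q_def)
      show "least_sieve_prime N w < Q" for w using least_sieve_prime_le[of N w] by (simp add: Q_def)
    qed (auto simp: Q_def)
    also have "\<dots> \<le> (2 * H) * ((2 * H) * E)" using hQ H1 E0 by (intro mult_right_mono) auto
    finally show ?thesis by (simp add: U_def power2_eq_square mult_ac)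
  qed
  have rewr: "(\<Sum>u=1..N. typeII_coeff N X u *
        (\<Sum>w=1..N div u. of_bool ((u * w) mod 4 = 1) *
           (of_bool (least_prime u \<le> least_sieve_prime N w) * e_char (real u * (real w * (real r * \<alpha>))))))
     = (\<Sum>i<n+1. \<Sum>c\<in>{1,3}. \<Sum>u\<in>{2^i..<2*2^i}. \<Sum>w=1..N div 2^i. A c u * B c w * K2 r u w)" for r
  proof -
    define G where "G u = (\<Sum>w=1..N. \<Sum>c\<in>{1,3}. A c u * B c w * K2 r u w)" for u
    \<comment> \<open>Since the kernel vanishes for \<open>u * w > N\<close>, the range of
      \<open>w\<close> may be chosen to depend on the block only and not on
      \<open>u\<close>.\<close>
    have K2_0: "K2 r u w = 0" if "w > 0" "N < u * w" for u w
      using that by (simp add: K2_def K1_def less_eq_div_iff_mult_less_eq)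
    have restrict: "G u = (\<Sum>w=1..N div v. \<Sum>c\<in>{1,3}. A c u * B c w * K2 r u w)" if v: "0 < v" "v \<le> u" for u v
      unfolding G_def
    proof (rule sum.mono_neutral_right)
      show "{1..N div v} \<subseteq> {1..N}" using div_le_dividend[of N v] by auto
      show "\<forall>w\<in>{1..N} - {1..N div v}. (\<Sum>c\<in>{1,3}. A c u * B c w * K2 r u w) = 0"
      proof
        fix w assume w: "w \<in> {1..N} - {1..N div v}"
        hence "N div v < w" by auto
        hence "N < w * v" using v by (simp add: div_less_iff_less_mult)
        also have "w * v \<le> u * w" using v by (simp add: mult.commute)
        finally show "(\<Sum>c\<in>{1,3}. A c u * B c w * K2 r u w) = 0" using K2_0 w by simp
      qed
    qed auto
    have "(\<Sum>u=1..N. typeII_coeff N X u *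
        (\<Sum>w=1..N div u. of_bool ((u * w) mod 4 = 1) *
           (of_bool (least_prime u \<le> least_sieve_prime N w) * e_char (real u * (real w * (real r * \<alpha>))))))
       = (\<Sum>u=1..N. G u)"
    proof (intro sum.cong refl)
      fix u assume u: "u \<in> {1..N}"
      show "typeII_coeff N X u *
        (\<Sum>w=1..N div u. of_bool ((u * w) mod 4 = 1) *
           (of_bool (least_prime u \<le> least_sieve_prime N w) * e_char (real u * (real w * (real r * \<alpha>))))) = G u"
      proof (cases "typeII_coeff N X u = 0")
        case True
        thus ?thesis by (simp add: G_def A_def)
      next
        case False
        note sup = typeII_coeff_support[OF False X]
        have "G u = (\<Sum>w=1..N div u. \<Sum>c\<in>{1,3}. A c u * B c w * K2 r u w)"
          using restrict[of u u] u by simp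
        also have "\<dots> = (\<Sum>w=1..N div u. typeII_coeff N X u * (of_bool ((u * w) mod 4 = 1) *
           (of_bool (least_prime u \<le> least_sieve_prime N w) * e_char (real u * (real w * (real r * \<alpha>))))))"
        proof (intro sum.cong refl)
          fix w assume w: "w \<in> {1..N div u}"
          hence "w * u \<le> N" using u by (simp add: less_eq_div_iff_mult_less_eq)
          hence "u \<le> N div w" using w by (simp add: less_eq_div_iff_mult_less_eq mult.commute)
          hence "K2 r u w = of_bool (least_prime u \<le> least_sieve_prime N w) * e_char (real u * (real w * (real r * \<alpha>)))"
            using sup(3) by (simp add: K2_def K1_def K_def min_absorb2 mult_ac)
          thus "(\<Sum>c\<in>{1,3}. A c u * B c w * K2 r u w) = typeII_coeff N X u * (of_bool ((u * w) mod 4 = 1) *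
           (of_bool (least_prime u \<le> least_sieve_prime N w) * e_char (real u * (real w * (real r * \<alpha>)))))"
            unfolding mult_mod_4_eq_1_iff[OF sup(4)] A_def B_def by (simp add: algebra_simps)
        qed
        finally show ?thesis by (simp only: sum_distrib_left)
      qed
    qed
    also have "\<dots> = (\<Sum>u\<in>{1..<2^(n+1)}. G u)"
    proof (rule sum.mono_neutral_left)
      show "\<forall>u\<in>{1..<2^(n+1)} - {1..N}. G u = 0"
      proof
        fix u assume u: "u \<in> {1..<2^(n+1)} - {1..N}"
        hence "N < u" by auto
        hence "K2 r u w = 0" if "w \<in> {1..N}" for w
          using that by (intro K2_0) (auto intro: less_le_trans)
        thus "G u = 0" by (simp add: G_def)
      qed
    qed (use n(2) in auto)
    also have "\<dots> = (\<Sum>i<n+1. \<Sum>u\<in>{2^i..<2*2^i}. G u)" by (rule sum_dyadic)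
    also have "\<dots> = (\<Sum>i<n+1. \<Sum>c\<in>{1,3}. \<Sum>u\<in>{2^i..<2*2^i}. \<Sum>w=1..N div 2^i. A c u * B c w * K2 r u w)"
    proof (rule sum.cong[OF refl])
      fix i
      have "(\<Sum>u\<in>{2^i..<2*2^i}. G u) = (\<Sum>u\<in>{2^i..<2*2^i}. \<Sum>w=1..N div 2^i. \<Sum>c\<in>{1,3}. A c u * B c w * K2 r u w)"
        by (intro sum.cong refl restrict) auto
      also have "\<dots> = (\<Sum>u\<in>{2^i..<2*2^i}. \<Sum>c\<in>{1,3}. \<Sum>w=1..N div 2^i. A c u * B c w * K2 r u w)"
        by (intro sum.cong refl sum.swap)
      also have "\<dots> = (\<Sum>c\<in>{1,3}. \<Sum>u\<in>{2^i..<2*2^i}. \<Sum>w=1..N div 2^i. A c u * B c w * K2 r u w)"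
        by (rule sum.swap)
      finally show "(\<Sum>u\<in>{2^i..<2*2^i}. G u) =
        (\<Sum>c\<in>{1,3}. \<Sum>u\<in>{2^i..<2*2^i}. \<Sum>w=1..N div 2^i. A c u * B c w * K2 r u w)" .
    qed
    finally show ?thesis .
  qed
  have "?lhs \<le> (\<Sum>r=1..R. \<Sum>i<n+1. \<Sum>c\<in>{1,3}. cmod (\<Sum>u\<in>{2^i..<2*2^i}. \<Sum>w=1..N div 2^i. A c u * B c w * K2 r u w))"
    unfolding rewr by (intro sum_mono sum_norm_le order.refl)
  also have "\<dots> = (\<Sum>i<n+1. \<Sum>r=1..R. \<Sum>c\<in>{1,3}. cmod (\<Sum>u\<in>{2^i..<2*2^i}. \<Sum>w=1..N div 2^i. A c u * B c w * K2 r u w))"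
    by (rule sum.swap)
  also have "\<dots> = (\<Sum>i<n+1. \<Sum>c\<in>{1,3}. \<Sum>r=1..R. cmod (\<Sum>u\<in>{2^i..<2*2^i}. \<Sum>w=1..N div 2^i. A c u * B c w * K2 r u w))"
    by (intro sum.cong refl sum.swap)
  also have "\<dots> \<le> (\<Sum>i<n+1. \<Sum>c\<in>{1,3::nat}. (2 * H)\<^sup>2 * E)"
    by (intro sum_mono dyad) auto
  also have "\<dots> = real (Suc n) * (2 * ((2 * H)\<^sup>2 * E))" by simp
  also have "\<dots> \<le> H * (2 * ((2 * H)\<^sup>2 * E))"
    using H(2)[OF n(1)] E0 by (intro mult_right_mono) auto
  also have "\<dots> = 48 * H ^ 6 * sqrt (real R * N * V)"
    by (simp add: E_def power_numeral_reduce mult_ac)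
  finally show ?thesis by (simp add: V_def)
qed

lemma sum_S_sum_le:
  assumes H: "\<And>n. n \<le> 8 * N\<^sup>2 \<Longrightarrow> harm n \<le> H" "\<And>k. 2 ^ k \<le> N \<Longrightarrow> real (Suc k) \<le> H"
    and q: "q \<le> 4 * N\<^sup>2" and R: "1 \<le> R" "R \<le> N"
    and X: "1 \<le> X" "real N \<le> X ^ 4" "X \<le> real N"
  shows "(\<Sum>r=1..R. cmod (\<Sum>n=1..N. b_char n * e_char (real n * (real r * \<alpha>))))
     \<le> 52 * H ^ 6 * sqrt (real R * N * (real R * X\<^sup>2 + real R * N / q + 2 * real N / X + q))"
proof -
  define V where "V = real R * X\<^sup>2 + real R * N / q + 2 * real N / X + q"
  have N: "N \<ge> 1" using R by simp
  have H1: "H \<ge> 1" using H(2)[of 0] N by simp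
  define T1 where "T1 r = (\<Sum>d=1..N. of_bool (real d \<le> X) * sieve_mu N d *
        (\<Sum>m=1..N div d. of_bool ((d * m) mod 4 = 1) * e_char (real m * (real d * (real r * \<alpha>)))))" for r :: nat
  define T2 where "T2 r = (\<Sum>u=1..N. typeII_coeff N X u *
        (\<Sum>w=1..N div u. of_bool ((u * w) mod 4 = 1) *
           (of_bool (least_prime u \<le> least_sieve_prime N w) * e_char (real u * (real w * (real r * \<alpha>))))))" for r :: nat
  have "(\<Sum>r=1..R. cmod (\<Sum>n=1..N. b_char n * e_char (real n * (real r * \<alpha>)))) = (\<Sum>r=1..R. cmod (T1 r + T2 r))"
    unfolding T1_def T2_def S_sum_eq[OF X(1)] ..
  also have "\<dots> \<le> (\<Sum>r=1..R. cmod (T1 r) + cmod (T2 r))"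
    by (intro sum_mono norm_triangle_ineq)
  also have "\<dots> = (\<Sum>r=1..R. cmod (T1 r)) + (\<Sum>r=1..R. cmod (T2 r))"
    by (rule sum.distrib)
  also have "(\<Sum>r=1..R. cmod (T1 r)) \<le> 4 * H ^ 3 * sqrt (real R * N * (real R * X + real R * N / q + q))"
    unfolding T1_def
  proof (rule typeI_le)
    show "harm (2 * q) \<le> H" using q by (intro H(1)) auto
    have "4 * (R * N) \<le> 8 * (N * N)" using R by (intro mult_le_mono) auto
    thus "harm (4 * (R * N)) \<le> H" by (intro H(1)) (simp only: power2_eq_square)
  qed (use X R in auto)
  also have "\<dots> \<le> 4 * H ^ 6 * sqrt (real R * N * V)"
  proof (intro mult_mono real_sqrt_le_mono)
    have "X * 1 \<le> X * X" using X by (intro mult_left_mono) auto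
    hence "real R * X \<le> real R * X\<^sup>2" by (intro mult_left_mono) (auto simp: power2_eq_square)
    moreover have "0 \<le> 2 * real N / X" using X by simp
    ultimately show "real R * X + real R * N / q + q \<le> V" unfolding V_def by linarith
    show "H ^ 3 \<le> H ^ 6" using H1 by (intro power_increasing) auto
  qed (use H1 X in auto)
  also have "(\<Sum>r=1..R. cmod (T2 r)) \<le> 48 * H ^ 6 * sqrt (real R * N * V)"
    unfolding T2_def V_def by (rule typeII_le) (use H q R N X in auto)
  finally show ?thesis by (simp add: V_def)
qed

end

section \<open>Optimisation and conclusion\<close>

lemma harm_le_one_plus_ln: "n \<ge> 1 \<Longrightarrow> harm n \<le> 1 + ln (real n)"
  using euler_mascheroni_sequence_decreasing[of 1 n] by (simp add: harm_def)

lemma log_power_le_powr: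
  fixes \<epsilon> :: real
  assumes "\<epsilon> > 0"
  obtains K :: real where "K > 0" "\<And>x. x \<ge> 1 \<Longrightarrow> (1 + ln (8 * x\<^sup>2)) ^ 6 * sqrt (ln x) \<le> K * x powr \<epsilon>"
proof -
  \<comment> \<open>Seven quantities, six logarithms and one square root, are each bounded by
    \<open>c * x powr \<delta>\<close>; \<open>c\<close> comes from
    \<open>ln x \<le> x powr \<delta> / \<delta>\<close>.\<close>
  define \<delta> where "\<delta> = \<epsilon> / 7"
  define c where "c = 10 + 2 / \<delta>"
  have \<delta>: "\<delta> > 0" using assms by (simp add: \<delta>_def)
  have c: "c > 0" using \<delta> unfolding c_def by (intro add_pos_pos) auto
  have "(1 + ln (8 * x\<^sup>2)) ^ 6 * sqrt (ln x) \<le> c ^ 7 * x powr \<epsilon>" if x: "x \<ge> 1" for x :: real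
  proof -
    have l: "0 \<le> ln x" using x by simp
    have p1: "1 \<le> x powr \<delta>" using x \<delta> by (simp add: ge_one_powr_ge_zero)
    have lp: "ln x \<le> x powr \<delta> / \<delta>" using x \<delta> by (rule ln_powr_bound)
    have "ln (8 * x\<^sup>2) = ln 8 + 2 * ln x" using x by (simp add: ln_mult ln_realpow)
    moreover have "ln (8::real) \<le> 8 - 1" by (rule ln_le_minus_one) simp
    moreover have "0 \<le> ln (8::real)" by simp
    ultimately have b: "1 + ln (8 * x\<^sup>2) \<le> 8 + 2 * ln x" "0 \<le> 1 + ln (8 * x\<^sup>2)" using l by linarith+
    have cx: "8 + 2 * ln x \<le> c * x powr \<delta>"
    proof -
      have "c * x powr \<delta> = 10 * x powr \<delta> + 2 * (x powr \<delta> / \<delta>)" by (simp add: c_def algebra_simps)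
      thus ?thesis using p1 lp by linarith
    qed
    have "sqrt (ln x) \<le> 1 + ln x"
      using l by (intro real_le_lsqrt) (auto simp: power2_eq_square algebra_simps)
    also have "\<dots> \<le> c * x powr \<delta>" using cx l by linarith
    finally have s: "sqrt (ln x) \<le> c * x powr \<delta>" .
    have "(1 + ln (8 * x\<^sup>2)) ^ 6 * sqrt (ln x) \<le> (c * x powr \<delta>) ^ 6 * (c * x powr \<delta>)"
      using b cx s l by (intro mult_mono power_mono) auto
    also have "\<dots> = c ^ 7 * (x powr \<delta>) ^ 7"
      by (simp add: power_mult_distrib power_numeral_reduce mult_ac)
    also have "(x powr \<delta>) ^ 7 = x powr \<epsilon>"
      using x by (simp add: powr_realpow[symmetric] powr_powr \<delta>_def)
    finally show ?thesis .
  qed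
  thus ?thesis using that[of "c ^ 7"] c by simp
qed

text \<open>The last two quantities are the square roots of \<open>r * n\<close> times
  \<open>r * X\<^sup>2\<close> and \<open>n / X\<close>. Both equal
  \<open>r powr (2/3) * n powr (5/6)\<close> at \<open>X ^ 3 = n / r\<close>; the second member of
  the maximum secures \<open>n \<le> X ^ 4\<close>.\<close>

lemma cutoff_optimisation:
  fixes r n :: real
  assumes r: "1 \<le> r" "r \<le> n"
  defines "X \<equiv> max ((n / r) powr (1/3)) (n powr (1/4))"
  shows "1 \<le> X" "n \<le> X ^ 4" "X \<le> n"
    "r * sqrt n * X \<le> r powr (2/3) * n powr (5/6) + r powr (4/3) * n powr (2/3)"
    "n * sqrt r / sqrt X \<le> r powr (2/3) * n powr (5/6)"
proof -
  have n: "1 \<le> n" using r by simp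
  have pos: "0 < r" "0 < n" using r by auto
  have X0: "0 < X" unfolding X_def using pos by (simp add: less_max_iff_disj)
  have X4: "n powr (1/4) \<le> X" and X3: "(n / r) powr (1/3) \<le> X" by (auto simp: X_def)
  have "1 \<le> n powr (1/4)" using n by (simp add: ge_one_powr_ge_zero)
  thus "1 \<le> X" using X4 by linarith
  have "n = (n powr (1/4)) ^ 4" using pos by (simp add: powr_realpow[symmetric] powr_powr)
  also have "\<dots> \<le> X ^ 4" using X4 by (intro power_mono) auto
  finally show "n \<le> X ^ 4" .
  have "n / r \<le> n / 1" using r by (intro divide_left_mono) auto
  hence nr: "n / r \<le> n" by simp
  have "(n / r) powr (1/3) \<le> n powr (1/3)" using nr pos by (intro powr_mono2) auto
  also have "\<dots> \<le> n powr 1" using n by (intro powr_mono) auto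
  finally have "(n / r) powr (1/3) \<le> n" using pos by simp
  moreover have "n powr (1/4) \<le> n powr 1" using n by (intro powr_mono) auto
  ultimately show "X \<le> n" using pos by (simp add: X_def)
  show "r * sqrt n * X \<le> r powr (2/3) * n powr (5/6) + r powr (4/3) * n powr (2/3)"
  proof (cases "X = (n / r) powr (1/3)")
    case True
    have "r * sqrt n * X = r powr 1 * n powr (1/2) * (n powr (1/3) * r powr (-(1/3)))"
      using pos True by (simp add: powr_half_sqrt powr_divide powr_minus field_simps)
    also have "\<dots> = (r powr 1 * r powr (-(1/3))) * (n powr (1/2) * n powr (1/3))" by (simp only: mult_ac)
    also have "\<dots> = r powr (2/3) * n powr (5/6)" by (simp only: powr_add[symmetric]) simp
    finally show ?thesis using pos by simp
  next
    case False
    hence X: "X = n powr (1/4)" "(n / r) powr (1/3) \<le> n powr (1/4)" unfolding X_def by linarith+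
    \<comment> \<open>That \<open>n powr (1/4)\<close> wins the maximum says just this, and it is
      the factor that turns \<open>r * n powr (3/4)\<close> into
      \<open>r powr (4/3) * n powr (2/3)\<close>.\<close>
    have "n powr (1/12) \<le> r powr (1/3)"
    proof -
      have "n powr (1/3) * r powr (-(1/3)) \<le> n powr (1/4)"
        using X(2) pos by (simp add: powr_divide powr_minus field_simps)
      hence "n powr (1/3) * r powr (-(1/3)) * (r powr (1/3) * n powr (-(1/4))) \<le> n powr (1/4) * (r powr (1/3) * n powr (-(1/4)))"
        by (rule mult_right_mono) simp
      hence "(n powr (1/3) * n powr (-(1/4))) * (r powr (-(1/3)) * r powr (1/3)) \<le> (n powr (1/4) * n powr (-(1/4))) * r powr (1/3)"
        by (simp only: mult_ac)
      hence "n powr (1/3 + -(1/4)) * r powr (-(1/3) + 1/3) \<le> n powr (1/4 + -(1/4)) * r powr (1/3)"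
        by (simp only: powr_add)
      thus ?thesis using pos by simp
    qed
    hence le: "r powr 1 * n powr (2/3) * n powr (1/12) \<le> r powr 1 * n powr (2/3) * r powr (1/3)"
      by (intro mult_left_mono) auto
    have "r * sqrt n * X = r powr 1 * (n powr (1/2) * n powr (1/4))"
      using pos X by (simp add: powr_half_sqrt)
    also have "\<dots> = r powr 1 * (n powr (2/3) * n powr (1/12))" by (simp only: powr_add[symmetric]) simp
    also have "\<dots> \<le> r powr 1 * n powr (2/3) * r powr (1/3)" using le by (simp only: mult.assoc)
    also have "\<dots> = (r powr 1 * r powr (1/3)) * n powr (2/3)" by (simp only: mult_ac)
    also have "\<dots> = r powr (4/3) * n powr (2/3)" by (simp only: powr_add[symmetric]) simp
    finally show ?thesis by (intro add_increasing) (use pos in auto)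
  qed
  have "sqrt ((n / r) powr (1/3)) \<le> sqrt X" using X3 by simp
  moreover have "sqrt ((n / r) powr (1/3)) = n powr (1/6) * r powr (-(1/6))"
  proof -
    have "sqrt ((n / r) powr (1/3)) = (n / r) powr (1/6)"
      using pos by (simp add: powr_half_sqrt[symmetric] powr_powr)
    thus ?thesis using pos by (simp add: powr_divide powr_minus field_simps)
  qed
  ultimately have "n * sqrt r / sqrt X \<le> n * sqrt r / (n powr (1/6) * r powr (-(1/6)))"
    using pos X0 by (intro divide_left_mono mult_pos_pos) auto
  also have "\<dots> = n powr 1 * r powr (1/2) * (n powr (-(1/6)) * r powr (1/6))"
    using pos by (simp add: powr_half_sqrt powr_minus field_simps)
  also have "\<dots> = (r powr (1/2) * r powr (1/6)) * (n powr 1 * n powr (-(1/6)))" by (simp only: mult_ac)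
  also have "\<dots> = r powr (2/3) * n powr (5/6)" by (simp only: powr_add[symmetric]) simp
  finally show "n * sqrt r / sqrt X \<le> r powr (2/3) * n powr (5/6)" .
qed

lemma sqrt_sum4_le:
  assumes "0 \<le> a" "0 \<le> b" "0 \<le> c" "0 \<le> d"
  shows "sqrt (a + b + c + d) \<le> sqrt a + sqrt b + sqrt c + sqrt d"
  using sqrt_add_le_add_sqrt[of "a + b + c" d] sqrt_add_le_add_sqrt[of "a + b" c] sqrt_add_le_add_sqrt[of a b] assms
  by linarith

lemma main_terms_le:
  fixes r n q :: real
  assumes r: "1 \<le> r" "r \<le> n" and q: "1 \<le> q"
  defines "X \<equiv> max ((n / r) powr (1/3)) (n powr (1/4))"
  shows "sqrt (r * n * (r * X\<^sup>2 + r * n / q + 2 * n / X + q))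
    \<le> 3 * (r * n / sqrt q + sqrt (r * n * q) + r powr (2/3) * n powr (5/6) + r powr (4/3) * n powr (2/3))"
proof -
  note opt = cutoff_optimisation[OF r, folded X_def]
  have pos: "0 < r" "0 < n" "0 < X" "0 < q" using r q opt(1) by auto
  have "sqrt (r * n * (r * X\<^sup>2 + r * n / q + 2 * n / X + q))
     = sqrt (r * n * (r * X\<^sup>2) + r * n * (r * n / q) + r * n * (2 * n / X) + r * n * q)"
    by (simp only: distrib_left)
  also have "\<dots> \<le> sqrt (r * n * (r * X\<^sup>2)) + sqrt (r * n * (r * n / q)) + sqrt (r * n * (2 * n / X)) + sqrt (r * n * q)"
    using pos by (intro sqrt_sum4_le) auto
  also have "sqrt (r * n * (r * X\<^sup>2)) = r * sqrt n * X"
  proof -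
    have "r * n * (r * X\<^sup>2) = (r * X)\<^sup>2 * n" by (simp add: power2_eq_square)
    thus ?thesis using pos by (simp add: real_sqrt_mult)
  qed
  also have "sqrt (r * n * (r * n / q)) = r * n / sqrt q"
  proof -
    have "r * n * (r * n / q) = (r * n)\<^sup>2 / q" by (simp add: power2_eq_square)
    thus ?thesis using pos by (simp add: real_sqrt_divide real_sqrt_mult)
  qed
  also have "sqrt (r * n * (2 * n / X)) \<le> 2 * (n * sqrt r / sqrt X)"
  proof -
    have "r * n * (2 * n / X) = 2 * (n\<^sup>2 * r / X)" by (simp add: power2_eq_square)
    hence "sqrt (r * n * (2 * n / X)) = sqrt 2 * (n * sqrt r / sqrt X)"
      using pos by (simp add: real_sqrt_divide real_sqrt_mult)
    also have "\<dots> \<le> 2 * (n * sqrt r / sqrt X)"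
      using pos sqrt2_less_2 by (intro mult_right_mono) auto
    finally show ?thesis .
  qed
  \<comment> \<open>The term \<open>r powr (2/3) * n powr (5/6)\<close> arises once from
    \<open>opt(4)\<close> and twice from \<open>opt(5)\<close>, hence the constant 3.\<close>
  finally show ?thesis using opt(4,5) pos
    by (smt (verit) mult_nonneg_nonneg powr_ge_zero real_sqrt_ge_zero divide_nonneg_nonneg)
qed

context rational_approx
begin

lemma sum_S_sum_le_main_terms:
  fixes N R :: real
  assumes N: "N \<ge> 2" and R: "1 \<le> R" "R \<le> N" and q: "real q \<le> R * N"
  shows "(\<Sum>r::nat | 0 < r \<and> real r \<le> R. cmod (S_sum (real r * \<alpha>) N))
     \<le> 156 * (1 + ln (8 * N\<^sup>2)) ^ 6 *
        (R * N / sqrt q + sqrt (R * N * q) + R powr (2/3) * N powr (5/6) + R powr (4/3) * N powr (2/3))"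
proof -
  define n r where "n = nat \<lfloor>N\<rfloor>" and "r = nat \<lfloor>R\<rfloor>"
  have n: "real n \<le> N" "N \<le> real n + 1" "1 \<le> n" "2 \<le> n" using N unfolding n_def by linarith+
  have r: "real r \<le> R" "1 \<le> r" using R unfolding r_def by linarith+
  have rn: "r \<le> n" unfolding n_def r_def using R by (intro nat_mono floor_mono)
  have setn: "{m. 0 < m \<and> real m \<le> N} = {1..n}" unfolding n_def using N by (auto; linarith)
  have setr: "{m. 0 < m \<and> real m \<le> R} = {1..r}" unfolding r_def using R by (auto; linarith)
  define H where "H = 1 + ln (8 * (real n)\<^sup>2)"
  define X where "X = max ((real n / real r) powr (1/3)) (real n powr (1/4))"
  have r': "1 \<le> real r" "real r \<le> real n" using r rn by auto
  note opt = cutoff_optimisation[OF r', folded X_def]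
  have lnH: "ln (8 * (real n)\<^sup>2) = ln 8 + 2 * ln (real n)" using n by (simp add: ln_mult ln_realpow)
  have ln0: "0 \<le> ln (8 * (real n)\<^sup>2)" using n lnH by simp
  have q': "q \<le> 4 * n\<^sup>2"
  proof -
    have "real q \<le> N * N" using q R N by (meson mult_right_mono order_trans zero_le_numeral)
    also have "\<dots> \<le> (2 * real n) * (2 * real n)" using n N by (intro mult_mono) auto
    also have "\<dots> = real (4 * n\<^sup>2)" by (simp add: power2_eq_square)
    finally show ?thesis by (simp only: of_nat_le_iff)
  qed
  have "(\<Sum>r::nat | 0 < r \<and> real r \<le> R. cmod (S_sum (real r * \<alpha>) N))
     = (\<Sum>k=1..r. cmod (\<Sum>m=1..n. b_char m * e_char (real m * (real k * \<alpha>))))"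
    unfolding S_sum_def setn setr ..
  also have "\<dots> \<le> 52 * H ^ 6 * sqrt (real r * n * (real r * X\<^sup>2 + real r * n / q + 2 * real n / X + q))"
  proof (rule sum_S_sum_le)
    fix m assume m: "m \<le> 8 * n\<^sup>2"
    show "harm m \<le> H"
    proof (cases "m = 0")
      case True
      thus ?thesis using ln0 by (simp add: H_def harm_def)
    next
      case False
      have "real m \<le> 8 * (real n)\<^sup>2" using m by (metis of_nat_le_iff of_nat_mult of_nat_numeral of_nat_power)
      hence "ln (real m) \<le> ln (8 * (real n)\<^sup>2)" using False n by (subst ln_le_cancel_iff) auto
      thus ?thesis using harm_le_one_plus_ln[of m] False by (simp add: H_def)
    qed
  next
    \<comment> \<open>\<open>H\<close> must also dominate the number of dyadic blocks;
      \<open>ln 2 \<ge> 1/2\<close> gives \<open>k \<le> 2 * ln n\<close>.\<close>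
    fix k assume k: "2 ^ k \<le> n"
    hence "2 ^ k \<le> real n" by (metis of_nat_le_iff of_nat_numeral of_nat_power)
    hence "ln (2 ^ k) \<le> ln (real n)" using n by simp
    hence "real k * ln 2 \<le> ln (real n)" by (simp add: ln_realpow)
    moreover have "real k * (1/2) \<le> real k * ln 2"
      using ln2_ge_two_thirds by (intro mult_left_mono) auto
    moreover have "0 \<le> ln (8::real)" by simp
    ultimately have "real k \<le> ln 8 + 2 * ln (real n)" by linarith
    thus "real (Suc k) \<le> H" unfolding H_def lnH by simp
  qed (use q' r rn opt in auto)
  also have "\<dots> \<le> 52 * H ^ 6 * (3 * (real r * n / sqrt q + sqrt (real r * n * q) +
      real r powr (2/3) * real n powr (5/6) + real r powr (4/3) * real n powr (2/3)))"
  proof (rule mult_left_mono)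
    show "sqrt (real r * n * (real r * X\<^sup>2 + real r * n / q + 2 * real n / X + q)) \<le>
      3 * (real r * n / sqrt q + sqrt (real r * n * q) +
      real r powr (2/3) * real n powr (5/6) + real r powr (4/3) * real n powr (2/3))"
      unfolding X_def by (rule main_terms_le) (use r' q_ge_1 in auto)
  qed (use ln0 in \<open>auto simp: H_def\<close>)
  also have "\<dots> = 156 * (H ^ 6 * (real r * n / sqrt q + sqrt (real r * n * q) +
      real r powr (2/3) * real n powr (5/6) + real r powr (4/3) * real n powr (2/3)))" by simp
  also have "\<dots> \<le> 156 * ((1 + ln (8 * N\<^sup>2)) ^ 6 * (R * N / sqrt q + sqrt (R * N * q) +
      R powr (2/3) * N powr (5/6) + R powr (4/3) * N powr (2/3)))"
  proof -
    have "ln (8 * (real n)\<^sup>2) \<le> ln (8 * N\<^sup>2)" using n by (simp add: power_mono)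
    hence 1: "H ^ 6 \<le> (1 + ln (8 * N\<^sup>2)) ^ 6" unfolding H_def using ln0 by (intro power_mono) auto
    have "real r * n / sqrt q \<le> R * N / sqrt q"
      using r n R N by (intro divide_right_mono mult_mono) auto
    moreover have "sqrt (real r * n * q) \<le> sqrt (R * N * q)"
      using r n R N by (intro real_sqrt_le_mono mult_right_mono mult_mono) auto
    moreover have "real r powr (2/3) * real n powr (5/6) \<le> R powr (2/3) * N powr (5/6)"
      "real r powr (4/3) * real n powr (2/3) \<le> R powr (4/3) * N powr (2/3)"
      using r n R N by (auto intro!: mult_mono powr_mono2)
    ultimately have 2: "real r * n / sqrt q + sqrt (real r * n * q) +
      real r powr (2/3) * real n powr (5/6) + real r powr (4/3) * real n powr (2/3)
      \<le> R * N / sqrt q + sqrt (R * N * q) + R powr (2/3) * N powr (5/6) + R powr (4/3) * N powr (2/3)"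
      by linarith
    from 1 2 have "H ^ 6 * (real r * n / sqrt q + sqrt (real r * n * q) +
      real r powr (2/3) * real n powr (5/6) + real r powr (4/3) * real n powr (2/3))
      \<le> (1 + ln (8 * N\<^sup>2)) ^ 6 * (R * N / sqrt q + sqrt (R * N * q) + R powr (2/3) * N powr (5/6) + R powr (4/3) * N powr (2/3))"
      by (rule mult_mono) simp_all
    thus ?thesis by simp
  qed
  finally show ?thesis by (simp only: mult.assoc)
qed

end

lemma S_sum_trivial:
  assumes "N \<ge> 0"
  shows "cmod (S_sum \<alpha> N) \<le> N"
proof -
  have "{m. 0 < m \<and> real m \<le> N} = {1..nat \<lfloor>N\<rfloor>}" using assms by (auto; linarith)
  hence "cmod (S_sum \<alpha> N) = cmod (\<Sum>n=1..nat \<lfloor>N\<rfloor>. b_char n * e_char (real n * \<alpha>))"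
    by (simp only: S_sum_def)
  also have "\<dots> \<le> (\<Sum>n=1..nat \<lfloor>N\<rfloor>. 1)"
    by (rule sum_norm_le) (simp add: norm_mult b_char_def)
  also have "\<dots> \<le> N" using assms by simp
  finally show ?thesis .
qed

theorem theorem1p8:
  fixes \<epsilon> :: real
  assumes "\<epsilon> > 0"
  shows "\<exists>C>0. \<forall>(\<alpha>::real) (\<beta>::real) (a::int) (q::nat) (N::real) (R::real).
    q \<ge> 1 \<longrightarrow> coprime a (int q) \<longrightarrow> \<alpha> = of_int a / real q + \<beta> \<longrightarrow>
    (real q)\<^sup>2 * \<bar>\<beta>\<bar> \<le> 1 \<longrightarrow> N \<ge> 2 \<longrightarrow> R \<ge> 1 \<longrightarrow>
    (\<Sum>r::nat | 0 < r \<and> real r \<le> R. cmod (S_sum (real r * \<alpha>) N))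
      \<le> C * (R * N / sqrt (ln N)
          * (1 / sqrt (real q) + sqrt (real q) / sqrt (R * N)
             + 1 / (R powr (1/3) * N powr (1/6)) + R powr (1/3) / N powr (1/3))
          * N powr \<epsilon>)"
proof -
  obtain K where K: "K > 0" "\<And>x. x \<ge> 1 \<Longrightarrow> (1 + ln (8 * x\<^sup>2)) ^ 6 * sqrt (ln x) \<le> K * x powr \<epsilon>"
    using log_power_le_powr[OF assms] by blast
  show ?thesis
  proof (rule exI[of _ "156 * K"], intro conjI allI impI)
    show "156 * K > 0" using K by simp
    fix \<alpha> \<beta> :: real and a :: int and q :: nat and N R :: real
    assume q: "q \<ge> 1" and cop: "coprime a (int q)" and \<alpha>: "\<alpha> = of_int a / real q + \<beta>"
      and \<beta>: "(real q)\<^sup>2 * \<bar>\<beta>\<bar> \<le> 1" and N: "N \<ge> 2" and R: "R \<ge> 1"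
    interpret rational_approx \<alpha> \<beta> a q
      by unfold_locales (fact q cop \<alpha> \<beta>)+
    define T where "T = 1 / sqrt (real q) + sqrt (real q) / sqrt (R * N)
             + 1 / (R powr (1/3) * N powr (1/6)) + R powr (1/3) / N powr (1/3)"
    define P where "P = (1 + ln (8 * N\<^sup>2)) ^ 6"
    let ?S = "\<Sum>r::nat | 0 < r \<and> real r \<le> R. cmod (S_sum (real r * \<alpha>) N)"
    have lnN: "ln N > 0" using N by simp
    have RN: "R * N > 0" using R N by simp
    have "N\<^sup>2 \<ge> 1" using N by (simp add: one_le_power)
    hence P1: "P \<ge> 1" unfolding P_def by (intro one_le_power) simp
    \<comment> \<open>This single inequality pays for all logarithms and for the claimed saving
      \<open>1 / sqrt (ln N)\<close>.\<close>
    have PK: "P \<le> K * N powr \<epsilon> / sqrt (ln N)"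
      using K(2)[of N] N lnN by (simp add: P_def field_simps)
    have T0: "T \<ge> 0" using RN by (simp add: T_def)
    have key: "?S \<le> 156 * P * (R * N * T)"
    proof (cases "R \<le> N \<and> real q \<le> R * N")
      case True
      have "?S \<le> 156 * P * (R * N / sqrt q + sqrt (R * N * q) + R powr (2/3) * N powr (5/6) + R powr (4/3) * N powr (2/3))"
        unfolding P_def using N R True by (intro sum_S_sum_le_main_terms) auto
      also have "R * N / sqrt q + sqrt (R * N * q) + R powr (2/3) * N powr (5/6) + R powr (4/3) * N powr (2/3) = R * N * T"
      proof -
        have "R * N * (sqrt q / sqrt (R * N)) = (R * N / sqrt (R * N)) * sqrt q" by simp
        also have "\<dots> = sqrt (R * N * q)"
          unfolding real_div_sqrt[OF less_imp_le[OF RN]] real_sqrt_mult[of "R * N"] ..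
        finally have "R * N * (sqrt q / sqrt (R * N)) = sqrt (R * N * q)" .
        moreover have "R * N * (1 / (R powr (1/3) * N powr (1/6))) = R powr (2/3) * N powr (5/6)"
        proof -
          have "R * N = (R powr (2/3) * R powr (1/3)) * (N powr (5/6) * N powr (1/6))"
            using R N by (simp only: powr_add[symmetric]) simp
          thus ?thesis using R N by (simp add: field_simps)
        qed
        moreover have "R * N * (R powr (1/3) / N powr (1/3)) = R powr (4/3) * N powr (2/3)"
        proof -
          have "R * R powr (1/3) = R powr (4/3)" "N = N powr (2/3) * N powr (1/3)"
            using R N powr_add[of R 1 "1/3"] powr_add[of N "2/3" "1/3"] by simp_all
          thus ?thesis using R N by (simp add: field_simps)
        qed
        ultimately show ?thesis unfolding T_def distrib_left by simp
      qed
      finally show ?thesis .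
    next
      case False
      \<comment> \<open>Outside the range of the main estimate one term is already at least 1: the
        second if \<open>q > R * N\<close>, the fourth if \<open>R > N\<close>. The trivial bound
        \<open>R * N\<close> then suffices.\<close>
      have T1: "T \<ge> 1"
      proof (cases "R \<le> N")
        case True
        hence "R * N \<le> real q" using False by simp
        hence "1 \<le> sqrt (real q) / sqrt (R * N)" using RN by simp
        moreover have "0 \<le> 1 / sqrt (real q)" "0 \<le> 1 / (R powr (1/3) * N powr (1/6))" "0 \<le> R powr (1/3) / N powr (1/3)"
          by auto
        ultimately show ?thesis unfolding T_def by linarith
      next
        case False
        hence "N powr (1/3) \<le> R powr (1/3)" using N by (intro powr_mono2) auto
        hence "1 \<le> R powr (1/3) / N powr (1/3)" using N by simp
        moreover have "0 \<le> 1 / sqrt (real q)" "0 \<le> 1 / (R powr (1/3) * N powr (1/6))" "0 \<le> sqrt (real q) / sqrt (R * N)"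
          using RN by auto
        ultimately show ?thesis unfolding T_def by linarith
      qed
      have "{r. 0 < r \<and> real r \<le> R} = {1..nat \<lfloor>R\<rfloor>}" using R by (auto; linarith)
      hence "?S = (\<Sum>r=1..nat \<lfloor>R\<rfloor>. cmod (S_sum (real r * \<alpha>) N))" by simp
      also have "\<dots> \<le> (\<Sum>r=1..nat \<lfloor>R\<rfloor>. N)" using N by (intro sum_mono S_sum_trivial) auto
      also have "\<dots> = real (nat \<lfloor>R\<rfloor>) * N" by simp
      also have "\<dots> \<le> R * N" using R N by (intro mult_right_mono) auto
      also have "\<dots> \<le> (156 * P) * (R * N * T)"
      proof -
        have "1 * (R * N * 1) \<le> (156 * P) * (R * N * T)"
          using P1 T1 RN by (intro mult_mono mult_left_mono) auto
        thus ?thesis by simp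
      qed
      finally show ?thesis .
    qed
    also have "\<dots> \<le> 156 * (K * N powr \<epsilon> / sqrt (ln N)) * (R * N * T)"
      using PK RN T0 by (intro mult_right_mono mult_left_mono) auto
    also have "\<dots> = 156 * K * (R * N / sqrt (ln N) * T * N powr \<epsilon>)" by simp
    finally show "?S \<le> 156 * K * (R * N / sqrt (ln N)
          * (1 / sqrt (real q) + sqrt (real q) / sqrt (R * N)
             + 1 / (R powr (1/3) * N powr (1/6)) + R powr (1/3) / N powr (1/3))
          * N powr \<epsilon>)" unfolding T_def .
  qed
qed

end
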